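(* Let $\mathcal{L}\subset \mathbb{P}^{2}_{\mathbb{C}}$ be a plus-one generated arrangement of $d$ lines with exponents $(d_{1}, d_{2}, d_{3})$, let $t_r$ denote the number of $r$-fold intersection points of $\mathcal{L}$, and set $$\mathcal{P}(\mathcal{L},d_{3};t) = 1 + dt + \left(\sum_{r\geq 2}(r-1)t_{r}-d_{3}\right)t^{2}.$$ Then the polynomial $\mathcal{P}(\mathcal{L},d_{3};t)$, in the variable $t$, splits over the rationals, and $$\mathcal{P}(\mathcal{L},d_{3};t) = (1+d_{1}t)(1+d_{2}t).$$
   Context: Let $S=\mathbb{C}[x,y,z]$ with its standard grading. An arrangement of $d$ lines $\mathcal{L}\subset\mathbb{P}^2_{\mathbb{C}}$ is a set of $d$ pairwise distinct lines; it is regarded as the reduced plane curve $f=0$ of degree $d$, where $f\in S$ is the product of linear forms defining the lines. An $r$-fold intersection point is a point lying on exactly $r$ lines of $\mathcal{L}$. For a reduced plane curve $C:f=0$ of degree $d$, let $J_f=\langle \partial_x f,\partial_y f,\partial_z f\rangle$ be the Jacobian ideal and $M(f)=S/J_f$ the Milnor algebra. $C$ is an $m$-syzygy curve with exponents $(d_1,\ldots,d_m)$ if $M(f)$ has a minimal graded free resolution $$0 \rightarrow \bigoplus_{i=1}^{m-2}S(-e_{i}) \rightarrow \bigoplus_{i=1}^{m}S(1-d - d_{i}) \rightarrow S^{3}(1-d)\rightarrow S \rightarrow M(f) \rightarrow 0$$ with $e_1\le\cdots\le e_{m-2}$ and $1\le d_1\le\cdots\le d_m$. $C$ is plus-one generated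 with exponents $(d_1,d_2,d_3)$ if it is a $3$-syzygy curve with these exponents and $d_1+d_2=d$. *)

theory Defs
  imports "HOL-Analysis.Analysis" "HOL-Library.Poly_Mapping"
    "HOL-Computational_Algebra.Polynomial"
begin

section \<open>The graded ring \<open>S = \<complex>[x, y, z]\<close>\<close>

text \<open>The three variables are indexed by the three-element type \<open>3\<close>; a monomial is its
  exponent vector, and a polynomial is a finitely supported family of coefficients.
  The product of \<^typ>\<open>'a \<Rightarrow>\<^sub>0 'b\<close> is the convolution product, i.e. polynomial multiplication.\<close>

type_synonym mono3 = "3 \<Rightarrow>\<^sub>0 nat"
type_synonym poly3 = "mono3 \<Rightarrow>\<^sub>0 complex"

definition mono_degree :: "mono3 \<Rightarrow> nat" where
  "mono_degree m = (\<Sum>i\<in>UNIV. Poly_Mapping.lookup m i)"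

text \<open>Degrees are integers so that twists may be negative; only \<open>0\<close> is homogeneous of
  negative degree, and \<open>0\<close> is homogeneous of every degree.\<close>

definition homogeneous :: "int \<Rightarrow> poly3 \<Rightarrow> bool" where
  "homogeneous k p \<longleftrightarrow> (\<forall>m\<in>Poly_Mapping.keys p. int (mono_degree m) = k)"

definition Var :: "3 \<Rightarrow> poly3" where
  "Var i = Poly_Mapping.single (Poly_Mapping.single i 1) 1"

definition Const :: "complex \<Rightarrow> poly3" where
  "Const c = Poly_Mapping.single 0 c"

text \<open>The truncated subtraction of exponents is harmless: it only occurs with coefficient \<open>0\<close>.\<close>

definition partial_deriv :: "3 \<Rightarrow> poly3 \<Rightarrow> poly3" where
  "partial_deriv i p =
     (\<Sum>m\<in>Poly_Mapping.keys p. Poly_Mapping.single (m - Poly_Mapping.single i 1)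
                    (of_nat (Poly_Mapping.lookup m i) * Poly_Mapping.lookup p m))"

definition ideal_gen :: "poly3 set \<Rightarrow> poly3 set" where
  "ideal_gen A = module.span (*) A"

definition irrelevant_ideal :: "poly3 set" where
  "irrelevant_ideal = ideal_gen (range Var)"

definition jacobian_ideal :: "poly3 \<Rightarrow> poly3 set" where
  "jacobian_ideal f = ideal_gen (range (\<lambda>i. partial_deriv i f))"

text \<open>The residue class of \<open>p\<close> in the Milnor algebra \<open>M(f) = S / J\<^sub>f\<close>, as a coset.\<close>

definition milnor_class :: "poly3 \<Rightarrow> poly3 \<Rightarrow> poly3 set" where
  "milnor_class f p = {q. q - p \<in> jacobian_ideal f}"

definition milnor_algebra :: "poly3 \<Rightarrow> poly3 set set" where
  "milnor_algebra f = range (milnor_class f)"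


section \<open>Graded free modules and minimal graded free resolutions\<close>

text \<open>A list \<open>as = [a\<^sub>0, \<dots>, a\<^sub>n\<^sub>-\<^sub>1]\<close> stands for the graded free module
  \<open>S(-a\<^sub>0) \<oplus> \<dots> \<oplus> S(-a\<^sub>n\<^sub>-\<^sub>1)\<close> (note the sign), where \<open>S(-a)\<^sub>k = S\<^sub>k\<^sub>-\<^sub>a\<close>.
  Its elements are the families of polynomials indexed by \<open>nat\<close> that vanish outside
  \<open>{..<n}\<close>.\<close>

definition free_module :: "int list \<Rightarrow> (nat \<Rightarrow> poly3) set" where
  "free_module as = {v. \<forall>i\<ge>length as. v i = 0}"

definition graded_part :: "int list \<Rightarrow> int \<Rightarrow> (nat \<Rightarrow> poly3) set" where
  "graded_part as k = {v \<in> free_module as. \<forall>i<length as. homogeneous (k - as ! i) (v i)}"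

definition graded_hom ::
    "int list \<Rightarrow> int list \<Rightarrow> ((nat \<Rightarrow> poly3) \<Rightarrow> (nat \<Rightarrow> poly3)) \<Rightarrow> bool" where
  "graded_hom as bs \<phi> \<longleftrightarrow>
     \<phi> \<in> free_module as \<rightarrow> free_module bs \<and>
     (\<forall>v\<in>free_module as. \<forall>w\<in>free_module as. \<phi> (\<lambda>i. v i + w i) = (\<lambda>i. \<phi> v i + \<phi> w i)) \<and>
     (\<forall>p. \<forall>v\<in>free_module as. \<phi> (\<lambda>i. p * v i) = (\<lambda>i. p * \<phi> v i)) \<and>
     (\<forall>k. \<phi> \<in> graded_part as k \<rightarrow> graded_part bs k)"

definition kernel ::
    "int list \<Rightarrow> ((nat \<Rightarrow> poly3) \<Rightarrow> (nat \<Rightarrow> poly3)) \<Rightarrow> (nat \<Rightarrow> poly3) set" where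
  "kernel as \<phi> = {v \<in> free_module as. \<phi> v = (\<lambda>i. 0)}"

text \<open>The image lies in \<open>\<mm> F\<close>, where \<open>\<mm>\<close> is the irrelevant ideal and \<open>F\<close> the target.\<close>

definition minimal_map ::
    "int list \<Rightarrow> ((nat \<Rightarrow> poly3) \<Rightarrow> (nat \<Rightarrow> poly3)) \<Rightarrow> bool" where
  "minimal_map as \<phi> \<longleftrightarrow> (\<forall>v\<in>free_module as. \<forall>i. \<phi> v i \<in> irrelevant_ideal)"

text \<open>\<open>0 \<rightarrow> F\<^sub>3 \<rightarrow> F\<^sub>2 \<rightarrow> F\<^sub>1 \<rightarrow> S \<rightarrow> M(f) \<rightarrow> 0\<close> is a minimal graded free resolution, where
  \<open>\<epsilon> : S \<rightarrow> M(f)\<close> is the canonical projection. Here \<open>S\<close> is the module \<open>free_module [0]\<close>.\<close>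

definition minimal_resolution_milnor ::
    "poly3 \<Rightarrow> int list \<Rightarrow> int list \<Rightarrow> int list \<Rightarrow> bool" where
  "minimal_resolution_milnor f F1 F2 F3 \<longleftrightarrow>
     (\<exists>\<phi>1 \<phi>2 \<phi>3. let \<epsilon> = (\<lambda>v. milnor_class f (v 0)) in
        graded_hom F1 [0] \<phi>1 \<and> graded_hom F2 F1 \<phi>2 \<and> graded_hom F3 F2 \<phi>3 \<and>
        minimal_map F1 \<phi>1 \<and> minimal_map F2 \<phi>2 \<and> minimal_map F3 \<phi>3 \<and>
        \<epsilon> ` free_module [0] = milnor_algebra f \<and>
        \<phi>1 ` free_module F1 = {v \<in> free_module [0]. \<epsilon> v = milnor_class f 0} \<and>
        \<phi>2 ` free_module F2 = kernel F1 \<phi>1 \<and>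
        \<phi>3 ` free_module F3 = kernel F2 \<phi>2 \<and>
        kernel F3 \<phi>3 = {\<lambda>i. 0})"

text \<open>\<open>m\<close>-syzygy curve \<open>f = 0\<close> of degree \<open>d\<close> with list of exponents \<open>ds\<close>, where \<open>m = length ds\<close>.
  Reducedness of the curve is not part of the definition; it holds for line arrangements.\<close>

definition syzygy_curve :: "nat \<Rightarrow> poly3 \<Rightarrow> nat list \<Rightarrow> bool" where
  "syzygy_curve d f ds \<longleftrightarrow>
     homogeneous (int d) f \<and> f \<noteq> 0 \<and> sorted ds \<and> (\<forall>a\<in>set ds. 1 \<le> a) \<and>
     (\<exists>es. length ds = length es + 2 \<and> sorted es \<and>
        minimal_resolution_milnor f
          (replicate 3 (int d - 1)) (map (\<lambda>a. int d - 1 + int a) ds) es)"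

definition plus_one_generated :: "nat \<Rightarrow> poly3 \<Rightarrow> nat \<Rightarrow> nat \<Rightarrow> nat \<Rightarrow> bool" where
  "plus_one_generated d f d1 d2 d3 \<longleftrightarrow> syzygy_curve d f [d1, d2, d3] \<and> d1 + d2 = d"


section \<open>Line arrangements in the complex projective plane\<close>

text \<open>Points and lines of \<open>\<pp>\<^sup>2\<close> are the linear subspaces of \<open>\<complex>\<^sup>3\<close> of dimension \<open>1\<close> and \<open>2\<close>;
  a point lies on a line iff it is contained in it.\<close>

definition proj_point :: "(complex^3) set \<Rightarrow> bool" where
  "proj_point P \<longleftrightarrow> vec.subspace P \<and> vec.dim P = 1"

definition proj_line :: "(complex^3) set \<Rightarrow> bool" where
  "proj_line L \<longleftrightarrow> vec.subspace L \<and> vec.dim L = 2"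

definition line_arrangement :: "(complex^3) set set \<Rightarrow> bool" where
  "line_arrangement \<L> \<longleftrightarrow> finite \<L> \<and> (\<forall>L\<in>\<L>. proj_line L)"

definition linear_form :: "complex^3 \<Rightarrow> poly3" where
  "linear_form a = (\<Sum>i\<in>UNIV. Const (a $ i) * Var i)"

definition defining_polynomial :: "(complex^3) set set \<Rightarrow> poly3 \<Rightarrow> bool" where
  "defining_polynomial \<L> f \<longleftrightarrow>
     (\<exists>a. (\<forall>L\<in>\<L>. L = {v. (\<Sum>i\<in>UNIV. a L $ i * v $ i) = 0}) \<and>
          f = (\<Prod>L\<in>\<L>. linear_form (a L)))"

definition num_points :: "(complex^3) set set \<Rightarrow> nat \<Rightarrow> nat" where
  "num_points \<L> r = card {P. proj_point P \<and> card {L \<in> \<L>. P \<subseteq> L} = r}"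

text \<open>The sum over all \<open>r \<ge> 2\<close> stops at the number of lines, as there are no points of
  higher multiplicity.\<close>

definition poincare_poly :: "(complex^3) set set \<Rightarrow> nat \<Rightarrow> rat poly" where
  "poincare_poly \<L> d3 =
     [:1, of_nat (card \<L>),
       (\<Sum>r = 2..card \<L>. (of_nat r - 1) * of_nat (num_points \<L> r)) - of_nat d3:]"

definition splits :: "'a::field poly \<Rightarrow> bool" where
  "splits p \<longleftrightarrow> (\<exists>c as. p = smult c (\<Prod>a\<leftarrow>as. [:- a, 1:]))"

end

theory Submission
  imports Defs "HOL-Library.Function_Algebras"
begin

text \<open>One compares two expressions for the Hilbert function of the module of logarithmic
  vector fields \<open>\<theta>\<close> of the arrangement, i.e. those with \<open>\<theta>(\<alpha>\<^sub>L) \<in> \<alpha>\<^sub>L S\<close> for every line \<open>L\<close>.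
  By \<open>\<theta> \<mapsto> \<theta>(f) / f\<close> this module is an extension of \<open>S(-1)\<close> by the syzygies of the Jacobian ideal,
  whose Hilbert function is read off the resolution. On the other hand, adding a line \<open>H\<close> to an
  arrangement of \<open>m\<close> lines imposes in every degree \<open>k \<ge> m\<close> exactly \<open>k + 1 - (m - n)\<close> conditions,
  where \<open>n\<close> is the number of points in which \<open>H\<close> meets the \<open>m\<close> lines: the restrictions of
  \<open>\<theta>(\<alpha>\<^sub>H)\<close> to \<open>H\<close> are the multiples of a form of degree \<open>m - n\<close>. Since \<open>n\<close> is also the
  increment of \<open>\<Sum>(r - 1) t\<^sub>r\<close>, that sum enters the constant term of the Hilbert polynomial.\<close>

section \<open>Dimension of subspaces of finitely spanned spaces\<close>

text \<open>Since d1 + d2 = d, the claim comes down to one number: the sum of (r - 1) t_r must be d1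
  d2 + d3. The exponents leave the degree e of the last generator of the resolution open; it is
  eliminated by comparing linear coefficients of two polynomials in the degree k before the constant
  ones are used. The extension by S(-1) comes from the Euler field, which sends f to d f. The form
  of degree m - n vanishes at each point of H on lines of the old arrangement, to an order one less
  than the number of these lines. Divisibility by it is a local statement at each point. That every
  multiple occurs is the harder half: to each point belongs a family of fields of constant
  direction, and these are combined by a Lagrange interpolation with polynomial coefficients. Such
  fields contain a product of m - 1 forms, whence the lower bound on k. Everything happens over the
  complex numbers in a fixed degree: exactness turns into rank-nullity, and divisibility by a linear
  form into vanishing of a restriction in C[t].\<close>

context vector_space
begin

lemma dim_zero: "dim {0} = 0"
  using dim_unique[of "{}" "{0}" 0] independent_empty by simp

text \<open>The graded pieces are finite-dimensional inside infinite-dimensional spaces, so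
  finiteness is supplied by a finite set spanning \<open>V\<close> and not by the ambient
  space.\<close>

lemma subspace_dim_equal_on:
  assumes "subspace U" "U \<subseteq> V" "finite B0" "V \<subseteq> span B0" "dim V \<le> dim U"
  shows "U = V"
proof -
  obtain BU where BU: "BU \<subseteq> U" "independent BU" "U \<subseteq> span BU" "card BU = dim U"
    using basis_exists by blast
  obtain B where B: "BU \<subseteq> B" "B \<subseteq> V" "independent B" "V \<subseteq> span B"
    using maximal_independent_subset_extend[of BU V] BU assms by blast
  have "finite B"
    using independent_span_bound[OF assms(3) B(3)] B assms by blast
  moreover have "card B = dim V"
    using basis_card_eq_dim B by blast
  ultimately have "BU = B"
    using B BU assms by (intro card_seteq) auto
  then show ?thesis
    using B BU assms span_minimal by blast
qed

end

context vector_space_pair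
begin

text \<open>The maps of a resolution are constrained only on \<open>free_module\<close>, so
  linearity is assumed on \<open>V\<close> alone. The proof replaces \<open>f\<close> by a linear
  map \<open>g\<close> that agrees with it on a basis of \<open>V\<close> extending one of the
  kernel.\<close>

lemma rank_nullity_on:
  assumes V: "vs1.subspace V" and fin: "finite B0" "V \<subseteq> vs1.span B0"
    and add: "\<And>x y. x \<in> V \<Longrightarrow> y \<in> V \<Longrightarrow> f (x + y) = f x + f y"
    and scale: "\<And>c x. x \<in> V \<Longrightarrow> f (s1 c x) = s2 c (f x)"
  shows "vs1.dim V = vs1.dim {v \<in> V. f v = 0} + vs2.dim (f ` V)"
proof -
  define K where "K = {v \<in> V. f v = 0}"
  have KV: "K \<subseteq> V" by (auto simp: K_def)
  obtain BK where BK: "BK \<subseteq> K" "vs1.independent BK" "K \<subseteq> vs1.span BK" "card BK = vs1.dim K"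
    using vs1.basis_exists by blast
  obtain B where B: "BK \<subseteq> B" "B \<subseteq> V" "vs1.independent B" "V \<subseteq> vs1.span B"
    using vs1.maximal_independent_subset_extend[of BK V] BK KV by blast
  have finB: "finite B"
    using vs1.independent_span_bound[OF fin(1) B(3)] B fin by blast
  have VB: "V = vs1.span B"
    using B V vs1.span_minimal by blast
  obtain g where g: "Vector_Spaces.linear s1 s2 g" "\<forall>x\<in>B. g x = f x"
    using linear_independent_extend[OF B(3)] by blast
  interpret g: Vector_Spaces.linear s1 s2 g by fact
  have "vs1.span B \<subseteq> {x \<in> V. f x = g x}"
  proof (rule vs1.span_minimal)
    have "f 0 = 0" using scale[of 0 0] vs1.subspace_0[OF V] by simp
    then show "vs1.subspace {x \<in> V. f x = g x}"
      using V by (auto simp: vs1.subspace_def add scale g.add g.scale g.zero)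
  qed (use B g in auto)
  then have fg: "f x = g x" if "x \<in> V" for x using that VB by blast
  define C where "C = B - BK"
  have indC: "vs1.independent C"
    using B(3) vs1.independent_mono C_def by blast
  have spC: "vs1.span C \<subseteq> V"
    unfolding VB C_def by (intro vs1.span_mono) auto
  have "x = 0" if x: "x \<in> vs1.span C" "g x = 0" for x
  proof -
    have "x \<in> vs1.span BK"
      using BK(3) spC x fg[of x] unfolding K_def by auto
    \<comment> \<open>A vector in both spans has one representation with respect to
      \<open>B\<close>; it is supported on \<open>C\<close> and on \<open>BK\<close>, which are
      disjoint, so it is zero.\<close>
    then have "vs1.representation C x = vs1.representation BK x"
      using vs1.representation_extend[OF B(3)] x B(1) C_def by (metis Diff_subset)
    then have "vs1.representation C x b = 0" for b
      using vs1.representation_ne_zero[of C x b] vs1.representation_ne_zero[of BK x b]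
      by (auto simp: C_def)
    then show "x = 0"
      using vs1.sum_nonzero_representation_eq[OF indC x(1)] by simp
  qed
  then have inj: "inj_on g (vs1.span C)"
    by (intro inj_onI) (metis eq_iff_diff_eq_0 g.diff vs1.span_diff)
  have "vs2.independent (g ` C)"
    by (rule linear_independent_injective_image[OF g(1) indC inj])
  moreover have "f ` V = vs2.span (g ` C)"
  proof -
    have "B = C \<union> BK" using B by (auto simp: C_def)
    have "g ` BK \<subseteq> {0}" using BK KV fg by (force simp: K_def)
    have "f ` V = g ` vs1.span B" using fg VB by auto
    also have "\<dots> = vs2.span (g ` B)" by (simp add: g.span_image)
    also have "\<dots> = vs2.span (g ` C)"
    proof (rule antisym)
      show "vs2.span (g ` B) \<subseteq> vs2.span (g ` C)"
        using \<open>g ` BK \<subseteq> {0}\<close> \<open>B = C \<union> BK\<close>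
        by (intro vs2.span_minimal) (auto intro: vs2.span_base intro!: vs2.span_zero simp: image_subset_iff)
    qed (use \<open>B = C \<union> BK\<close> in \<open>auto intro!: vs2.span_mono\<close>)
    finally show ?thesis .
  qed
  ultimately have "vs2.dim (f ` V) = card (g ` C)"
    by (simp add: vs2.dim_eq_card_independent)
  also have "\<dots> = card C"
    using inj vs1.span_superset inj_on_subset card_image by metis
  finally show ?thesis
    using B BK finB vs1.basis_card_eq_dim[OF B(2,4,3)] card_mono[OF finB B(1)] finite_subset[OF B(1) finB]
    by (simp add: C_def card_Diff_subset flip: K_def)
qed

end


section \<open>Homogeneous polynomials in three variables\<close>

lemma poly_mapping_induct [case_names zero single add]:
  fixes p :: "'a \<Rightarrow>\<^sub>0 'b::monoid_add"
  assumes "P 0" "\<And>m c. P (Poly_Mapping.single m c)" "\<And>p q. P p \<Longrightarrow> P q \<Longrightarrow> P (p + q)"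
  shows "P p"
proof (induction p rule: update_induct)
  case (update p m c)
  have "Poly_Mapping.update m c p = p + Poly_Mapping.single m c"
    using update(1)
    by (intro poly_mapping_eqI) (auto simp: lookup_update lookup_add lookup_single when_def in_keys_iff)
  then show ?case using assms update by simp
qed (use assms in auto)

lemma mono_degree_add: "mono_degree (m + n) = mono_degree m + mono_degree n"
  by (simp add: mono_degree_def lookup_add sum.distrib)

lemma mono_degree_single [simp]: "mono_degree (Poly_Mapping.single i n) = n"
  by (simp add: mono_degree_def lookup_single when_def)

lemma mono_degree_zero [simp]: "mono_degree 0 = 0"
  by (simp add: mono_degree_def)

lemma Const_add: "Const (a + b) = Const a + Const b"
  and Const_mult: "Const (a * b) = Const a * Const b"
  and Const_0 [simp]: "Const 0 = 0"
  and Const_1 [simp]: "Const 1 = 1"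
  by (simp_all add: Const_def single_add mult_single)

lemma Const_eq_0_iff [simp]: "Const a = 0 \<longleftrightarrow> a = 0"
  by (metis Const_0 Const_def inj_single injD)

lemma lookup_Const_mult: "Poly_Mapping.lookup (Const c * p) m = c * Poly_Mapping.lookup p m"
  unfolding Const_def by (simp add: Poly_Mapping.map.rep_eq when_def flip: mult_map_scale_conv_mult)

definition pscale :: "complex \<Rightarrow> poly3 \<Rightarrow> poly3" where
  "pscale c p = Const c * p"

definition mscale :: "complex \<Rightarrow> (nat \<Rightarrow> poly3) \<Rightarrow> nat \<Rightarrow> poly3" where
  "mscale c v = (\<lambda>i. Const c * v i)"

interpretation poly3: vector_space pscale
  by unfold_locales (auto simp: pscale_def Const_add Const_mult algebra_simps)

interpretation fmod: vector_space mscale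
  by unfold_locales (auto simp: mscale_def Const_add Const_mult algebra_simps fun_eq_iff)

interpretation upoly: vector_space "smult :: complex \<Rightarrow> complex poly \<Rightarrow> complex poly"
  by unfold_locales (auto simp: smult_add_left smult_add_right)

interpretation fmod_fmod: vector_space_pair mscale mscale ..
interpretation fmod_poly3: vector_space_pair mscale pscale ..
interpretation fmod_upoly: vector_space_pair mscale "smult :: complex \<Rightarrow> complex poly \<Rightarrow> complex poly" ..
interpretation poly3_upoly: vector_space_pair pscale "smult :: complex \<Rightarrow> complex poly \<Rightarrow> complex poly" ..
interpretation poly3_poly3: vector_space_pair pscale pscale ..
interpretation upoly_upoly: vector_space_pair "smult :: complex \<Rightarrow> complex poly \<Rightarrow> complex poly"
  "smult :: complex \<Rightarrow> complex poly \<Rightarrow> complex poly" ..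

lemma homogeneous_iff:
  "homogeneous k p \<longleftrightarrow> (\<forall>m. int (mono_degree m) \<noteq> k \<longrightarrow> Poly_Mapping.lookup p m = 0)"
  by (auto simp: homogeneous_def in_keys_iff)

lemma homogeneous_0 [simp]: "homogeneous k 0"
  by (simp add: homogeneous_def)

lemma homogeneous_add: "homogeneous k p \<Longrightarrow> homogeneous k q \<Longrightarrow> homogeneous k (p + q)"
  by (simp add: homogeneous_iff lookup_add)

lemma homogeneous_diff: "homogeneous k p \<Longrightarrow> homogeneous k q \<Longrightarrow> homogeneous k (p - q)"
  by (simp add: homogeneous_iff lookup_minus)

lemma homogeneous_sum: "(\<And>x. x \<in> A \<Longrightarrow> homogeneous k (f x)) \<Longrightarrow> homogeneous k (sum f A)"
  by (simp add: homogeneous_iff lookup_sum)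

lemma homogeneous_mult: "homogeneous a p \<Longrightarrow> homogeneous b q \<Longrightarrow> homogeneous (a + b) (p * q)"
  using keys_mult[of p q] by (fastforce simp: homogeneous_def mono_degree_add)

lemma homogeneous_Const [simp]: "homogeneous 0 (Const c)"
  by (simp add: homogeneous_iff Const_def lookup_single when_def)

lemma homogeneous_1 [simp]: "homogeneous 0 1"
  using homogeneous_Const[of 1] by simp

lemma homogeneous_Var [simp]: "homogeneous 1 (Var i)"
  by (simp add: homogeneous_iff Var_def lookup_single when_def)

lemma homogeneous_Const_mult: "homogeneous k p \<Longrightarrow> homogeneous k (Const c * p)"
  using homogeneous_mult[of 0 "Const c" k p] by simp

lemma homogeneous_power: "homogeneous a p \<Longrightarrow> homogeneous (int n * a) (p ^ n)"
  by (induction n) (auto simp: algebra_simps homogeneous_mult)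

lemma homogeneous_prod:
  "(\<And>x. x \<in> A \<Longrightarrow> homogeneous (g x) (f x)) \<Longrightarrow> homogeneous (sum g A) (prod f A)"
  by (induction A rule: infinite_finite_induct) (auto simp: homogeneous_mult)

lemma homogeneous_linear_form [simp]: "homogeneous 1 (linear_form a)"
  unfolding linear_form_def by (intro homogeneous_sum homogeneous_Const_mult) simp

lemma homogeneous_neg_degree: "homogeneous k p \<Longrightarrow> k < 0 \<Longrightarrow> p = 0"
  by (intro poly_mapping_eqI) (auto simp: homogeneous_iff)

section \<open>Homogeneous components of a polynomial\<close>

lift_definition hcomp :: "int \<Rightarrow> poly3 \<Rightarrow> poly3" is
  "\<lambda>k p m. if int (mono_degree m) = k then p m else 0"
  by (rule finite_subset) auto

lemma hcomp_add: "hcomp k (p + q) = hcomp k p + hcomp k q"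
  by (rule poly_mapping_eqI) (simp add: hcomp.rep_eq lookup_add)

lemma hcomp_0 [simp]: "hcomp k 0 = 0"
  by (rule poly_mapping_eqI) (simp add: hcomp.rep_eq)

lemma homogeneous_hcomp: "homogeneous k (hcomp k p)"
  by (simp add: homogeneous_iff hcomp.rep_eq)

lemma hcomp_homogeneous: "homogeneous k p \<Longrightarrow> hcomp j p = (if j = k then p else 0)"
  by (rule poly_mapping_eqI) (auto simp: homogeneous_iff hcomp.rep_eq)

lemma hcomp_eventually_0:
  obtains K where "finite K" "\<And>k. k \<notin> K \<Longrightarrow> hcomp k p = 0"
proof
  show "finite ((int \<circ> mono_degree) ` Poly_Mapping.keys p)" by simp
  show "hcomp k p = 0" if "k \<notin> (int \<circ> mono_degree) ` Poly_Mapping.keys p" for k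
    using that by (intro poly_mapping_eqI) (auto simp: hcomp.rep_eq in_keys_iff image_iff)
qed

lemma sum_hcomp:
  assumes "finite K" "\<And>k. k \<notin> K \<Longrightarrow> hcomp k p = 0"
  shows "(\<Sum>k\<in>K. hcomp k p) = p"
proof (rule poly_mapping_eqI)
  fix m
  have "Poly_Mapping.lookup p m = 0" if "int (mono_degree m) \<notin> K"
    using assms(2)[OF that] by (metis hcomp.rep_eq lookup_zero)
  then show "Poly_Mapping.lookup (\<Sum>k\<in>K. hcomp k p) m = Poly_Mapping.lookup p m"
    using assms(1) by (auto simp: lookup_sum hcomp.rep_eq)
qed

section \<open>The Hilbert function of S\<close>

definition hilb :: "int \<Rightarrow> nat" where
  "hilb k = card {m. int (mono_degree m) = k}"

lemma bij_betw_monomials: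
  "bij_betw (\<lambda>(a, b). Poly_Mapping.single 1 a + Poly_Mapping.single 2 b + Poly_Mapping.single 3 (n - a - b))
     (SIGMA a:{..n}. {..n - a}) {m::mono3. mono_degree m = n}"
proof (rule bij_betwI[where g = "\<lambda>m. (Poly_Mapping.lookup m 1, Poly_Mapping.lookup m 2)"])
  show "(\<lambda>(a, b). Poly_Mapping.single 1 a + Poly_Mapping.single 2 b + Poly_Mapping.single 3 (n - a - b))
     \<in> (SIGMA a:{..n}. {..n - a}) \<rightarrow> {m::mono3. mono_degree m = n}"
    by (auto simp: mono_degree_add)
next
  fix m :: mono3 assume "m \<in> {m. mono_degree m = n}"
  then have n: "n = Poly_Mapping.lookup m 1 + Poly_Mapping.lookup m 2 + Poly_Mapping.lookup m 3"
    by (simp add: mono_degree_def sum_3)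
  show "(case (Poly_Mapping.lookup m 1, Poly_Mapping.lookup m 2) of
      (a, b) \<Rightarrow> Poly_Mapping.single 1 a + Poly_Mapping.single 2 b + Poly_Mapping.single 3 (n - a - b)) = m"
  proof (rule poly_mapping_eqI)
    fix i :: 3
    show "Poly_Mapping.lookup (case (Poly_Mapping.lookup m 1, Poly_Mapping.lookup m 2) of
      (a, b) \<Rightarrow> Poly_Mapping.single 1 a + Poly_Mapping.single 2 b + Poly_Mapping.single 3 (n - a - b)) i
       = Poly_Mapping.lookup m i"
      using exhaust_3[of i] n by (auto simp: lookup_add lookup_single)
  qed
qed (auto simp: mono_degree_def sum_3 lookup_add lookup_single)

lemma finite_monomials: "finite {m. int (mono_degree m) = k}"
proof (cases "k < 0")
  case False
  then obtain n where "k = int n" using nonneg_int_cases by (metis linorder_not_less)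
  then show ?thesis using bij_betw_finite[OF bij_betw_monomials[of n]] by simp
qed simp

lemma hilb_neg: "k < 0 \<Longrightarrow> hilb k = 0"
  by (auto simp: hilb_def card_eq_0_iff)

lemma sum_rev_nat: "2 * (\<Sum>a\<le>n. Suc (n - a)) = (n + 1) * (n + 2)"
proof -
  have "(\<Sum>a\<le>n. Suc (n - a)) = (\<Sum>a\<le>n. Suc a)"
    by (rule sum.reindex_bij_witness[of _ "\<lambda>a. n - a" "\<lambda>a. n - a"]) auto
  also have "2 * \<dots> = (n + 1) * (n + 2)" by (induction n) auto
  finally show ?thesis .
qed

text \<open>The binomial formula survives at -1 and -2, where it vanishes as the Hilbert function
  does. The value at -1 is needed when degrees 0 and -1 are compared.\<close>

lemma hilb_eq: 
  assumes "k \<ge> -2"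
  shows "2 * int (hilb k) = (k + 1) * (k + 2)"
proof (cases "k < 0")
  case True
  then have "k = -1 \<or> k = -2" using assms by auto
  then show ?thesis by (auto simp: hilb_neg)
next
  case False
  then obtain n where n: "k = int n" using nonneg_int_cases by (metis linorder_not_less)
  have "hilb k = card (SIGMA a:{..n}. {..n - a})"
    using bij_betw_same_card[OF bij_betw_monomials[of n]] by (simp add: hilb_def n)
  also have "\<dots> = (\<Sum>a\<le>n. Suc (n - a))" by (simp add: card_SigmaI)
  finally have "2 * hilb k = (n + 1) * (n + 2)" by (simp only: sum_rev_nat)
  then have "int (2 * hilb k) = int ((n + 1) * (n + 2))" by (rule arg_cong)
  then show ?thesis by (simp add: n algebra_simps)
qed

lemma subspace_homogeneous: "poly3.subspace {p. homogeneous k p}"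
  by (auto simp: poly3.subspace_def homogeneous_add pscale_def homogeneous_Const_mult)

lemma single_sum_monomials:
  "finite A \<Longrightarrow> Poly_Mapping.keys p \<subseteq> A \<Longrightarrow>
    (\<Sum>m\<in>A. Const (Poly_Mapping.lookup p m) * Poly_Mapping.single m 1) = p"
  by (rule poly_mapping_eqI)
     (auto simp: lookup_sum lookup_Const_mult lookup_single when_def in_keys_iff if_distrib cong: if_cong)

lemma homogeneous_span:
  "{p. homogeneous k p} \<subseteq> poly3.span ((\<lambda>m. Poly_Mapping.single m 1) ` {m. int (mono_degree m) = k})"
proof
  fix p assume "p \<in> {p. homogeneous k p}"
  then have "Poly_Mapping.keys p \<subseteq> {m. int (mono_degree m) = k}" by (auto simp: homogeneous_def)
  from single_sum_monomials[OF finite_monomials this, symmetric]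
  show "p \<in> poly3.span ((\<lambda>m. Poly_Mapping.single m 1) ` {m. int (mono_degree m) = k})"
    by (metis (no_types, lifting) imageI poly3.span_base poly3.span_scale poly3.span_sum pscale_def)
qed

lemma inj_monomial: "inj (\<lambda>m::mono3. Poly_Mapping.single m (1::complex))"
  by (metis (mono_tags, lifting) injI lookup_single_eq lookup_single_not_eq zero_neq_one)

lemma independent_monomials: "poly3.independent ((\<lambda>m. Poly_Mapping.single m 1) ` A)"
proof -
  show ?thesis unfolding poly3.independent_explicit_finite_subsets
  proof (intro allI impI ballI)
    fix B u b assume B: "B \<subseteq> (\<lambda>m::mono3. Poly_Mapping.single m 1) ` A" "finite B" 
      "(\<Sum>v\<in>B. pscale (u v) v) = 0" "b \<in> B"
    then obtain m where m: "b = Poly_Mapping.single m 1" by auto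
    have "Poly_Mapping.lookup (pscale (u v) v) m = (if v = b then u b else 0)" if v: "v \<in> B" for v
    proof -
      obtain n where "v = Poly_Mapping.single n 1" using v B(1) by auto
      then show ?thesis using m
        by (auto simp: pscale_def lookup_Const_mult lookup_single when_def inj_eq[OF inj_monomial])
    qed
    then have "Poly_Mapping.lookup (\<Sum>v\<in>B. pscale (u v) v) m = (\<Sum>v\<in>B. if v = b then u b else 0)"
      unfolding lookup_sum by (rule sum.cong[OF refl])
    then show "u b = 0" using B by simp
  qed
qed

lemma dim_homogeneous: "poly3.dim {p. homogeneous k p} = hilb k"
proof (rule poly3.dim_unique[OF _ homogeneous_span independent_monomials])
  show "card ((\<lambda>m. Poly_Mapping.single m (1::complex)) ` {m. int (mono_degree m) = k}) = hilb k"
    unfolding hilb_def by (rule card_image[OF inj_on_subset[OF inj_monomial subset_UNIV]])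
qed (auto simp: homogeneous_iff lookup_single when_def)

lemma poly3_finite_spanned:
  assumes "V \<subseteq> {p. homogeneous k p}"
  obtains B where "finite B" "V \<subseteq> poly3.span B"
  using assms homogeneous_span[of k] finite_monomials[of k] by (meson finite_imageI subset_trans that)

section \<open>Partial derivatives are derivations\<close>

lemma partial_deriv_single:
  "partial_deriv i (Poly_Mapping.single m c) =
     Poly_Mapping.single (m - Poly_Mapping.single i 1) (of_nat (Poly_Mapping.lookup m i) * c)"
  by (cases "c = 0") (auto simp: partial_deriv_def)

lemma partial_deriv_0 [simp]: "partial_deriv i 0 = 0"
  by (simp add: partial_deriv_def)

lemma partial_deriv_add: "partial_deriv i (p + q) = partial_deriv i p + partial_deriv i q"
  unfolding partial_deriv_def by (rule setsum_keys_plus_distrib) (auto simp: single_add algebra_simps)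

lemma partial_deriv_mult:
  "partial_deriv i (p * q) = partial_deriv i p * q + p * partial_deriv i q"
proof (induction p rule: poly_mapping_induct)
  case (single m c)
  show ?case
  proof (induction q rule: poly_mapping_induct)
    case (single n b)
    let ?e = "Poly_Mapping.single i (1::nat)"
    \<comment> \<open>Truncated subtraction commutes with the addition of exponents only if the
      exponent of the variable is positive; otherwise the corresponding Leibniz term has coefficient
      0, which is the reason for the case split below.\<close>
    have "n + (m - ?e) = m + n - ?e" if "Poly_Mapping.lookup m i \<noteq> 0" for m n
      using that by (intro poly_mapping_eqI) (auto simp: lookup_add lookup_minus lookup_single when_def)
    note this[of m n] this[of n m]
    then show ?case
      by (cases "Poly_Mapping.lookup m i = 0"; cases "Poly_Mapping.lookup n i = 0")
         (auto simp: partial_deriv_single mult_single lookup_add algebra_simps simp flip: single_add)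
  qed (auto simp: partial_deriv_add algebra_simps)
qed (auto simp: partial_deriv_add algebra_simps)

lemma partial_deriv_Const [simp]: "partial_deriv i (Const c) = 0"
  by (simp add: Const_def partial_deriv_single)

lemma partial_deriv_Var: "partial_deriv i (Var j) = (if i = j then 1 else 0)"
  by (auto simp: Var_def partial_deriv_single lookup_single when_def)

lemma partial_deriv_sum: "partial_deriv i (sum f A) = (\<Sum>x\<in>A. partial_deriv i (f x))"
  by (induction A rule: infinite_finite_induct) (auto simp: partial_deriv_add)

lemma partial_deriv_linear_form: "partial_deriv i (linear_form a) = Const (a $ i)"
proof -
  have "partial_deriv i (linear_form a) = (\<Sum>j\<in>UNIV. if i = j then Const (a $ j) else 0)"
    unfolding linear_form_def partial_deriv_sum partial_deriv_mult
    by (intro sum.cong) (auto simp: partial_deriv_Var)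
  then show ?thesis by simp
qed

lemma homogeneous_partial_deriv: 
  assumes "homogeneous k p" shows "homogeneous (k - 1) (partial_deriv i p)"
  unfolding partial_deriv_def
proof (rule homogeneous_sum)
  fix m assume m: "m \<in> Poly_Mapping.keys p"
  show "homogeneous (k - 1) (Poly_Mapping.single (m - Poly_Mapping.single i 1)
     (of_nat (Poly_Mapping.lookup m i) * Poly_Mapping.lookup p m))"
  proof (cases "Poly_Mapping.lookup m i = 0")
    case False
    then have "m = (m - Poly_Mapping.single i 1) + Poly_Mapping.single i 1"
      by (intro poly_mapping_eqI) (auto simp: lookup_add lookup_minus lookup_single when_def)
    then have "mono_degree m = mono_degree (m - Poly_Mapping.single i 1) + 1"
      by (metis mono_degree_add mono_degree_single)
    then show ?thesis using assms m by (auto simp: homogeneous_def lookup_single when_def)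
  qed simp
qed

section \<open>Substitution of one-variable polynomials for the variables\<close>

definition psubst :: "(3 \<Rightarrow> complex poly) \<Rightarrow> poly3 \<Rightarrow> complex poly" where
  "psubst x p = (\<Sum>m\<in>Poly_Mapping.keys p. smult (Poly_Mapping.lookup p m) (\<Prod>i\<in>UNIV. x i ^ Poly_Mapping.lookup m i))"

lemma psubst_0 [simp]: "psubst x 0 = 0"
  by (simp add: psubst_def)

lemma psubst_single: "psubst x (Poly_Mapping.single m c) = smult c (\<Prod>i\<in>UNIV. x i ^ Poly_Mapping.lookup m i)"
  by (cases "c = 0") (auto simp: psubst_def)

lemma psubst_add: "psubst x (p + q) = psubst x p + psubst x q"
  unfolding psubst_def by (rule setsum_keys_plus_distrib) (auto simp: smult_add_left)

lemma psubst_diff: "psubst x (p - q) = psubst x p - psubst x q"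
  using psubst_add[of x "p - q" q] by simp

lemma psubst_mult: "psubst x (p * q) = psubst x p * psubst x q"
proof (induction p rule: poly_mapping_induct)
  case (single m c)
  show ?case
  proof (induction q rule: poly_mapping_induct)
    case (single n b)
    then show ?case by (simp add: mult_single psubst_single lookup_add power_add prod.distrib)
  qed (auto simp: psubst_add algebra_simps)
qed (auto simp: psubst_add algebra_simps)

lemma psubst_Const: "psubst x (Const c) = [:c:]"
  by (simp add: Const_def psubst_single)

lemma psubst_1 [simp]: "psubst x 1 = 1"
  using psubst_Const[of x 1] by simp

lemma psubst_Var: "psubst x (Var j) = x j"
proof -
  have "(\<Prod>i\<in>UNIV. x i ^ Poly_Mapping.lookup (Poly_Mapping.single j 1) i) = (\<Prod>i\<in>UNIV. if i = j then x i else 1)"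
    by (intro prod.cong) (auto simp: lookup_single when_def)
  then show ?thesis by (simp add: Var_def psubst_single)
qed

lemma psubst_sum: "psubst x (sum f A) = (\<Sum>a\<in>A. psubst x (f a))"
  by (induction A rule: infinite_finite_induct) (auto simp: psubst_add)

lemma psubst_prod: "psubst x (prod f A) = (\<Prod>a\<in>A. psubst x (f a))"
  by (induction A rule: infinite_finite_induct) (auto simp: psubst_mult)

lemma psubst_power: "psubst x (p ^ n) = psubst x p ^ n"
  by (induction n) (auto simp: psubst_mult)

lemma degree_psubst:
  assumes "homogeneous (int k) p" "\<And>i. degree (x i) \<le> 1"
  shows "degree (psubst x p) \<le> k"
  unfolding psubst_def
proof (rule degree_sum_le)
  fix m assume "m \<in> Poly_Mapping.keys p"
  then have k: "k = (\<Sum>i\<in>UNIV. Poly_Mapping.lookup m i)"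
    using assms by (auto simp: homogeneous_def mono_degree_def simp del: of_nat_sum)
  have "degree (\<Prod>i\<in>UNIV. x i ^ Poly_Mapping.lookup m i) \<le> (\<Sum>i\<in>UNIV. degree (x i ^ Poly_Mapping.lookup m i))"
    using degree_prod_sum_le[of UNIV "\<lambda>i. x i ^ Poly_Mapping.lookup m i"] by (simp add: o_def)
  also have "\<dots> \<le> (\<Sum>i\<in>UNIV. Poly_Mapping.lookup m i)"
    using assms(2) by (intro sum_mono order.trans[OF degree_power_le]) (metis mult_le_mono1 mult_1)
  finally show "degree (smult (Poly_Mapping.lookup p m) (\<Prod>i\<in>UNIV. x i ^ Poly_Mapping.lookup m i)) \<le> k"
    using k degree_smult_le order.trans by metis
qed simp


section \<open>Hilbert functions from resolutions\<close>

lemma sum_fun_apply: "sum f A i = (\<Sum>x\<in>A. f x i)" for f :: "'a \<Rightarrow> 'b \<Rightarrow> 'c::comm_monoid_add"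
  by (induction A rule: infinite_finite_induct) auto

section \<open>Graded components of elements of free modules\<close>

definition gcomp :: "int list \<Rightarrow> int \<Rightarrow> (nat \<Rightarrow> poly3) \<Rightarrow> nat \<Rightarrow> poly3" where
  "gcomp as k v = (\<lambda>i. if i < length as then hcomp (k - as ! i) (v i) else 0)"

lemma free_module_add: "v \<in> free_module as \<Longrightarrow> w \<in> free_module as \<Longrightarrow> v + w \<in> free_module as"
  by (simp add: free_module_def)

lemma free_module_0 [simp]: "0 \<in> free_module as"
  by (simp add: free_module_def)

lemma free_module_sum: "(\<And>x. x \<in> A \<Longrightarrow> f x \<in> free_module as) \<Longrightarrow> sum f A \<in> free_module as"
  by (induction A rule: infinite_finite_induct) (auto simp: free_module_add)

lemma graded_part_subset: "graded_part as k \<subseteq> free_module as"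
  by (auto simp: graded_part_def)

lemma subspace_graded_part: "fmod.subspace (graded_part as k)"
  by (auto simp: fmod.subspace_def graded_part_def free_module_def mscale_def homogeneous_add homogeneous_Const_mult)

lemma gcomp_graded: "gcomp as k v \<in> graded_part as k"
  by (auto simp: gcomp_def graded_part_def free_module_def homogeneous_hcomp)

lemma gcomp_free: "gcomp as k v \<in> free_module as"
  using gcomp_graded graded_part_subset by blast

lemma gcomp_add: "gcomp as k (v + w) = gcomp as k v + gcomp as k w"
  by (auto simp: gcomp_def fun_eq_iff hcomp_add)

lemma gcomp_0 [simp]: "gcomp as k 0 = 0"
  by (auto simp: gcomp_def fun_eq_iff)

lemma gcomp_sum: "gcomp as k (sum f A) = (\<Sum>x\<in>A. gcomp as k (f x))"
  by (induction A rule: infinite_finite_induct)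
     (simp_all only: sum.infinite sum.empty sum.insert gcomp_add gcomp_0 not_False_eq_True)

lemma gcomp_of_graded: "v \<in> graded_part as k \<Longrightarrow> gcomp as j v = (if j = k then v else 0)"
  by (auto simp: gcomp_def fun_eq_iff graded_part_def free_module_def hcomp_homogeneous)

lemma sum_gcomp:
  assumes "v \<in> free_module as"
  obtains K where "finite K" "\<And>k. k \<notin> K \<Longrightarrow> gcomp as k v = 0" "(\<Sum>k\<in>K. gcomp as k v) = v"
proof -
  have "\<exists>K. finite K \<and> (\<forall>k. k \<notin> K \<longrightarrow> hcomp k (v i) = 0)" for i
    using hcomp_eventually_0 by metis
  then obtain Ki where Ki: "\<And>i. finite (Ki i)" "\<And>i k. k \<notin> Ki i \<Longrightarrow> hcomp k (v i) = 0"
    by metis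
  \<comment> \<open>The degrees occurring in coordinate \<open>i\<close> are moved by its twist
    \<open>as ! i\<close>, so that all coordinates share one set of total degrees.\<close>
  define K where "K = (\<Union>i<length as. (\<lambda>k. k + as ! i) ` Ki i)"
  have fin: "finite K" using Ki by (simp add: K_def)
  have 0: "hcomp (k - as ! i) (v i) = 0" if "k \<notin> K" "i < length as" for k i
  proof (rule Ki)
    show "k - as ! i \<notin> Ki i" using that by (force simp: K_def)
  qed
  have "(\<Sum>k\<in>K. gcomp as k v) i = v i" for i
  proof (cases "i < length as")
    case True
    have "(\<Sum>k\<in>K. hcomp (k - as ! i) (v i)) = (\<Sum>k\<in>(\<lambda>k. k - as ! i) ` K. hcomp k (v i))"
      by (subst sum.reindex) (auto simp: inj_on_def)
    also have "\<dots> = v i"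
    proof (rule sum_hcomp)
      fix k assume "k \<notin> (\<lambda>k. k - as ! i) ` K"
      then have "k + as ! i \<notin> K" by (auto simp: image_iff)
      from 0[OF this True] show "hcomp k (v i) = 0" by simp
    qed (use fin in simp)
    finally show ?thesis using True by (simp add: sum_fun_apply gcomp_def)
  next
    case False
    then show ?thesis using assms by (simp add: sum_fun_apply gcomp_def free_module_def)
  qed
  then have "(\<Sum>k\<in>K. gcomp as k v) = v" by blast
  moreover have "gcomp as k v = 0" if "k \<notin> K" for k
    using 0[OF that] by (auto simp: gcomp_def fun_eq_iff)
  ultimately show ?thesis using that fin by blast
qed

context
  fixes as bs :: "int list" and \<phi>
  assumes \<phi>: "graded_hom as bs \<phi>"
begin

lemma graded_hom_add:
  "v \<in> free_module as \<Longrightarrow> w \<in> free_module as \<Longrightarrow> \<phi> (v + w) = \<phi> v + \<phi> w"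
  using \<phi> by (auto simp: graded_hom_def plus_fun_def)

lemma graded_hom_scale: "v \<in> free_module as \<Longrightarrow> \<phi> (mscale c v) = mscale c (\<phi> v)"
  using \<phi> by (auto simp: graded_hom_def mscale_def)

lemma graded_hom_0: "\<phi> 0 = 0"
  using graded_hom_scale[of 0 0] by simp

lemma graded_hom_sum:
  "(\<And>x. x \<in> A \<Longrightarrow> f x \<in> free_module as) \<Longrightarrow> \<phi> (sum f A) = (\<Sum>x\<in>A. \<phi> (f x))"
  by (induction A rule: infinite_finite_induct)
     (auto simp: graded_hom_0 graded_hom_add free_module_sum)

lemma graded_hom_gcomp:
  assumes v: "v \<in> free_module as"
  shows "\<phi> (gcomp as k v) = gcomp bs k (\<phi> v)"
proof -
  obtain K where K: "finite K" "\<And>k. k \<notin> K \<Longrightarrow> gcomp as k v = 0" "(\<Sum>k\<in>K. gcomp as k v) = v"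
    using sum_gcomp[OF v] by blast
  have gr: "\<phi> (gcomp as j v) \<in> graded_part bs j" for j
    using \<phi> gcomp_graded unfolding graded_hom_def by blast
  have "gcomp bs k (\<phi> v) = (\<Sum>j\<in>K. gcomp bs k (\<phi> (gcomp as j v)))"
    by (subst K(3)[symmetric]) (simp add: graded_hom_sum gcomp_free gcomp_sum)
  also have "\<dots> = (\<Sum>j\<in>K. if j = k then \<phi> (gcomp as k v) else 0)"
    by (intro sum.cong) (auto simp: gcomp_of_graded[OF gr])
  also have "\<dots> = \<phi> (gcomp as k v)"
    using K by (auto simp: graded_hom_0)
  finally show ?thesis ..
qed

text \<open>A graded map commutes with taking components, so a homogeneous image is already the
  image of the component of the same degree. This allows exactness to be read degree by
  degree.\<close>

lemma graded_hom_image: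
  "\<phi> ` graded_part as k = \<phi> ` free_module as \<inter> graded_part bs k"
proof
  show "\<phi> ` graded_part as k \<subseteq> \<phi> ` free_module as \<inter> graded_part bs k"
    using \<phi> graded_part_subset by (auto simp: graded_hom_def)
  show "\<phi> ` free_module as \<inter> graded_part bs k \<subseteq> \<phi> ` graded_part as k"
  proof
    fix w assume "w \<in> \<phi> ` free_module as \<inter> graded_part bs k"
    then obtain v where v: "w = \<phi> v" "v \<in> free_module as" "w \<in> graded_part bs k" by blast
    then have "w = \<phi> (gcomp as k v)" using graded_hom_gcomp gcomp_of_graded by metis
    then show "w \<in> \<phi> ` graded_part as k" using gcomp_graded by blast
  qed
qed

end

lemma graded_part_finite_spanned:
  obtains B where "finite B" "graded_part as k \<subseteq> fmod.span B"
proof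
  let ?e = "\<lambda>i p j. if j = i then p else (0::poly3)"
  let ?S = "\<lambda>i. (\<lambda>m. Poly_Mapping.single m 1) ` {m. int (mono_degree m) = k - as ! i} :: poly3 set"
  let ?B = "\<Union>i<length as. ?e i ` ?S i"
  show "finite ?B" by (simp add: finite_monomials)
  show "graded_part as k \<subseteq> fmod.span ?B"
  proof
    fix v assume v: "v \<in> graded_part as k"
    interpret poly3_fmod: vector_space_pair pscale mscale ..
    have *: "?e i (v i) \<in> fmod.span ?B" if "i < length as" for i
    proof -
      interpret e: Vector_Spaces.linear pscale mscale "?e i"
        by unfold_locales (auto simp: fun_eq_iff mscale_def pscale_def)
      have "v i \<in> poly3.span (?S i)"
        using homogeneous_span[of "k - as ! i"] v that by (auto simp: graded_part_def)
      then have "?e i (v i) \<in> fmod.span (?e i ` ?S i)"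
        unfolding e.span_image by blast
      moreover have "?e i ` ?S i \<subseteq> ?B" using that by blast
      ultimately show ?thesis by (meson fmod.span_mono in_mono)
    qed
    have "v = (\<Sum>i<length as. ?e i (v i))"
      using v by (auto simp: fun_eq_iff sum_fun_apply graded_part_def free_module_def)
    also have "\<dots> \<in> fmod.span ?B" using * by (intro fmod.span_sum) auto
    finally show "v \<in> fmod.span ?B" .
  qed
qed

text \<open>Projection to the last coordinate is onto a graded piece of S, and its kernel is the
  graded part for the list without its last entry. Induction from the right keeps the positions of
  the other coordinates.\<close>

lemma dim_graded_part: "fmod.dim (graded_part as k) = (\<Sum>a\<leftarrow>as. hilb (k - a))"
proof (induction as rule: rev_induct)
  case Nil
  have "graded_part [] k = {0}" by (auto simp: graded_part_def free_module_def)
  then show ?case by (simp add: fmod.dim_zero)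
next
  case (snoc a as)
  obtain B where B: "finite B" "graded_part (as @ [a]) k \<subseteq> fmod.span B"
    using graded_part_finite_spanned .
  have "fmod.dim (graded_part (as @ [a]) k) = fmod.dim {v \<in> graded_part (as @ [a]) k. v (length as) = 0}
      + poly3.dim ((\<lambda>v. v (length as)) ` graded_part (as @ [a]) k)"
    by (rule fmod_poly3.rank_nullity_on[OF subspace_graded_part B]) (auto simp: mscale_def pscale_def)
  also have "{v \<in> graded_part (as @ [a]) k. v (length as) = 0} = graded_part as k"
  proof (intro set_eqI iffI)
    fix v assume v: "v \<in> {v \<in> graded_part (as @ [a]) k. v (length as) = 0}"
    have "v i = 0" if "i \<ge> length as" for i
      using v that by (cases "i = length as") (auto simp: graded_part_def free_module_def)
    moreover have "homogeneous (k - as ! i) (v i)" if "i < length as" for i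
      using v that by (auto simp: graded_part_def nth_append dest!: spec[of _ i])
    ultimately show "v \<in> graded_part as k" by (auto simp: graded_part_def free_module_def)
  next
    fix v assume "v \<in> graded_part as k"
    then show "v \<in> {v \<in> graded_part (as @ [a]) k. v (length as) = 0}"
      by (auto simp: graded_part_def free_module_def nth_append)
  qed
  also have "(\<lambda>v. v (length as)) ` graded_part (as @ [a]) k = {p. homogeneous (k - a) p}"
  proof (intro set_eqI iffI)
    fix p assume "p \<in> (\<lambda>v. v (length as)) ` graded_part (as @ [a]) k"
    then show "p \<in> {p. homogeneous (k - a) p}"
      by (auto simp: graded_part_def dest!: spec[of _ "length as"])
  next
    fix p assume "p \<in> {p. homogeneous (k - a) p}"
    then have "(\<lambda>i. if i = length as then p else 0) \<in> graded_part (as @ [a]) k"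
      by (auto simp: graded_part_def free_module_def nth_append)
    then show "p \<in> (\<lambda>v. v (length as)) ` graded_part (as @ [a]) k"
      by (rule rev_image_eqI) simp
  qed
  finally show ?case using snoc by (simp add: dim_homogeneous)
qed

text \<open>Along an exact sequence the image term of one instance is the kernel term of the next,
  so the instances add up to an alternating sum of Hilbert functions.\<close>

lemma graded_hom_rank_nullity:
  assumes "graded_hom as bs \<phi>"
  shows "fmod.dim (graded_part as k) =
    fmod.dim (kernel as \<phi> \<inter> graded_part as k) + fmod.dim (\<phi> ` free_module as \<inter> graded_part bs k)"
proof -
  obtain B where B: "finite B" "graded_part as k \<subseteq> fmod.span B"
    using graded_part_finite_spanned .
  have "fmod.dim (graded_part as k) = fmod.dim {v \<in> graded_part as k. \<phi> v = 0}
      + fmod.dim (\<phi> ` graded_part as k)"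
    using graded_part_subset
    by (intro fmod_fmod.rank_nullity_on[OF subspace_graded_part B])
       (blast intro: graded_hom_add[OF assms] graded_hom_scale[OF assms])+
  moreover have "{v \<in> graded_part as k. \<phi> v = 0} = kernel as \<phi> \<inter> graded_part as k"
    using graded_part_subset by (auto simp: kernel_def zero_fun_def)
  ultimately show ?thesis
    by (simp add: graded_hom_image[OF assms])
qed

text \<open>A triple is read as a derivation of S. Its coordinates count from 0, as in
  \<open>free_module\<close>, while the variables are indexed by 1, 2, 3.\<close>

definition vfield :: "(nat \<Rightarrow> poly3) \<Rightarrow> poly3 \<Rightarrow> poly3" where
  "vfield v p = v 0 * partial_deriv 1 p + v 1 * partial_deriv 2 p + v 2 * partial_deriv 3 p"

lemma vfield_add: "vfield (v + w) p = vfield v p + vfield w p"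
  by (simp add: vfield_def algebra_simps)

lemma vfield_smult: "vfield (\<lambda>i. q * v i) p = q * vfield v p"
  by (simp only: vfield_def distrib_left mult.assoc)

lemma vfield_scale: "vfield (mscale c v) p = pscale c (vfield v p)"
  by (simp add: mscale_def pscale_def vfield_smult)

lemma vfield_mult: "vfield v (p * q) = vfield v p * q + p * vfield v q"
  by (simp add: vfield_def partial_deriv_mult algebra_simps)

interpretation ring_module: module "(*) :: poly3 \<Rightarrow> poly3 \<Rightarrow> poly3"
  by unfold_locales (auto simp: algebra_simps)

text \<open>Translates the Jacobian ideal into derivations. As \<open>vfield\<close> reads only
  three coordinates, \<open>v\<close> may range over all functions.\<close>

lemma jacobian_ideal_eq: "jacobian_ideal f = range (\<lambda>v. vfield v f)"
proof
  have "ring_module.subspace (range (\<lambda>v. vfield v f))"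
    unfolding ring_module.subspace_def
  proof (intro conjI allI impI ballI)
    show "0 \<in> range (\<lambda>v. vfield v f)" by (rule range_eqI[of _ _ 0]) (simp add: vfield_def)
    show "x + y \<in> range (\<lambda>v. vfield v f)" if "x \<in> range (\<lambda>v. vfield v f)" "y \<in> range (\<lambda>v. vfield v f)" for x y
      using that by (auto simp flip: vfield_add)
    show "c * x \<in> range (\<lambda>v. vfield v f)" if x: "x \<in> range (\<lambda>v. vfield v f)" for c x
    proof -
      obtain v where "x = vfield v f" using x by blast
      then have "c * x = vfield (\<lambda>i. c * v i) f" by (simp only: vfield_smult)
      then show ?thesis by blast
    qed
  qed
  moreover have "partial_deriv i f \<in> range (\<lambda>v. vfield v f)" for i
  proof -
    have "partial_deriv 1 f = vfield (\<lambda>j. if j = 0 then 1 else 0) f"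
      "partial_deriv 2 f = vfield (\<lambda>j. if j = 1 then 1 else 0) f"
      "partial_deriv 3 f = vfield (\<lambda>j. if j = 2 then 1 else 0) f"
      by (simp_all add: vfield_def)
    then show ?thesis using exhaust_3[of i] by blast
  qed
  ultimately show "jacobian_ideal f \<subseteq> range (\<lambda>v. vfield v f)"
    unfolding jacobian_ideal_def ideal_gen_def by (intro ring_module.span_minimal) auto
  show "range (\<lambda>v. vfield v f) \<subseteq> jacobian_ideal f"
    unfolding jacobian_ideal_def ideal_gen_def vfield_def
    by (rule image_subsetI)
      (intro ring_module.span_add ring_module.span_scale ring_module.span_base rangeI)
qed

lemma milnor_class_eq_0_iff: "milnor_class f p = milnor_class f 0 \<longleftrightarrow> p \<in> jacobian_ideal f"
proof
  assume "milnor_class f p = milnor_class f 0"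
  moreover have "p \<in> milnor_class f p"
    by (simp add: milnor_class_def jacobian_ideal_def ideal_gen_def ring_module.span_zero)
  ultimately show "p \<in> jacobian_ideal f" by (simp add: milnor_class_def)
next
  assume p: "p \<in> jacobian_ideal f"
  have "q - p \<in> jacobian_ideal f \<longleftrightarrow> q \<in> jacobian_ideal f" for q
    using p ring_module.span_diff[of q _ p] ring_module.span_add[of "q - p" _ p]
    by (auto simp: jacobian_ideal_def ideal_gen_def)
  then show "milnor_class f p = milnor_class f 0"
    by (simp add: milnor_class_def)
qed

text \<open>The standard presentation of the Jacobian ideal by the three partial derivatives, to be
  compared with the unspecified first map of a resolution.\<close>

definition jacobian_map :: "poly3 \<Rightarrow> (nat \<Rightarrow> poly3) \<Rightarrow> nat \<Rightarrow> poly3" where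
  "jacobian_map f v = (\<lambda>i. if i = 0 then vfield v f else 0)"

lemma homogeneous_vfield:
  assumes "homogeneous d f" "\<And>i. i < 3 \<Longrightarrow> homogeneous k (v i)"
  shows "homogeneous (k + d - 1) (vfield v f)"
proof -
  have "homogeneous (k + (d - 1)) (v i * partial_deriv j f)" if "i < 3" for i j
    using that assms by (intro homogeneous_mult homogeneous_partial_deriv) auto
  then show ?thesis unfolding vfield_def
    by (intro homogeneous_add) (simp_all add: algebra_simps)
qed

lemma graded_hom_jacobian_map:
  assumes "homogeneous d f"
  shows "graded_hom (replicate 3 (d - 1)) [0] (jacobian_map f)"
proof -
  have "homogeneous k (vfield v f)" if "v \<in> graded_part (replicate 3 (d - 1)) k" for v k
    using homogeneous_vfield[OF assms, of "k - (d - 1)" v] that by (auto simp: graded_part_def)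
  moreover have "jacobian_map f \<in> free_module (replicate 3 (d - 1)) \<rightarrow> free_module [0]"
    by (auto simp: jacobian_map_def free_module_def)
  moreover have "jacobian_map f (\<lambda>i. v i + w i) = (\<lambda>i. jacobian_map f v i + jacobian_map f w i)" for v w
    using vfield_add[of v w f] by (auto simp: jacobian_map_def plus_fun_def)
  moreover have "jacobian_map f (\<lambda>i. p * v i) = (\<lambda>i. p * jacobian_map f v i)" for v p
    by (auto simp: jacobian_map_def vfield_smult)
  ultimately show ?thesis
    unfolding graded_hom_def by (intro conjI ballI allI funcsetI)
      (auto simp: jacobian_map_def graded_part_def free_module_def)
qed

lemma image_jacobian_map:
  "jacobian_map f ` free_module (replicate 3 a) = {v \<in> free_module [0]. milnor_class f (v 0) = milnor_class f 0}"
proof (intro set_eqI iffI)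
  fix w assume "w \<in> {v \<in> free_module [0]. milnor_class f (v 0) = milnor_class f 0}"
  then have w: "w \<in> free_module [0]" "w 0 \<in> range (\<lambda>v. vfield v f)"
    by (auto simp: milnor_class_eq_0_iff jacobian_ideal_eq)
  then obtain v where v: "w 0 = vfield v f" by blast
  have "w = jacobian_map f (\<lambda>i. if i < 3 then v i else 0)"
    using w v by (auto simp: fun_eq_iff jacobian_map_def free_module_def vfield_def)
  moreover have "(\<lambda>i. if i < 3 then v i else 0) \<in> free_module (replicate 3 a)"
    by (auto simp: free_module_def)
  ultimately show "w \<in> jacobian_map f ` free_module (replicate 3 a)" by blast
qed (auto simp: milnor_class_eq_0_iff jacobian_ideal_eq jacobian_map_def free_module_def)

text \<open>Graded by the degree \<open>k\<close> of the coefficients; in the resolution the same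
  element has degree k + (d - 1).\<close>

definition syzygies :: "poly3 \<Rightarrow> int \<Rightarrow> (nat \<Rightarrow> poly3) set" where
  "syzygies f k = {v \<in> graded_part (replicate 3 0) k. vfield v f = 0}"

lemma graded_part_shift: "graded_part (replicate n a) (k + a) = graded_part (replicate n 0) k"
  by (auto simp: graded_part_def free_module_def)

lemma sum_list_int: "(\<Sum>a\<leftarrow>as. int (f a)) = int (\<Sum>a\<leftarrow>as. f a)"
  by (induction as) auto

lemma dim_syzygies:
  assumes f: "homogeneous d f" and res: "minimal_resolution_milnor f (replicate 3 (d - 1)) F2 F3"
  shows "int (fmod.dim (syzygies f k)) =
    (\<Sum>a\<leftarrow>F2. int (hilb (k + (d - 1) - a))) - (\<Sum>a\<leftarrow>F3. int (hilb (k + (d - 1) - a)))"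
proof -
  let ?F1 = "replicate 3 (d - 1)" and ?j = "k + (d - 1)"
  from res obtain \<phi>1 \<phi>2 \<phi>3 where h: "graded_hom ?F1 [0] \<phi>1" "graded_hom F2 ?F1 \<phi>2" "graded_hom F3 F2 \<phi>3"
    and ex: "\<phi>1 ` free_module ?F1 = {v \<in> free_module [0]. milnor_class f (v 0) = milnor_class f 0}"
      "\<phi>2 ` free_module F2 = kernel ?F1 \<phi>1" "\<phi>3 ` free_module F3 = kernel F2 \<phi>2"
      "kernel F3 \<phi>3 = {\<lambda>i. 0}"
    by (auto simp: minimal_resolution_milnor_def Let_def)
  have "{\<lambda>i. 0} \<inter> graded_part F3 ?j = {0}"
    using fmod.subspace_0[OF subspace_graded_part] by (auto simp: zero_fun_def)
  then have "fmod.dim ({\<lambda>i. 0} \<inter> graded_part F3 ?j) = 0"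
    by (simp add: fmod.dim_zero)
  moreover have "kernel ?F1 (jacobian_map f) \<inter> graded_part ?F1 ?j = syzygies f k"
    unfolding syzygies_def graded_part_shift[of 3 "d - 1" k, symmetric]
    using graded_part_subset by (auto simp: kernel_def jacobian_map_def fun_eq_iff)
  \<comment> \<open>The map \<open>\<phi>1\<close> need not be \<open>jacobian_map f\<close>, but
    both have the same source and the same image, hence kernels of equal dimension in each
    degree.\<close>
  ultimately show ?thesis
    using graded_hom_rank_nullity[OF h(1), of ?j] graded_hom_rank_nullity[OF h(2), of ?j]
      graded_hom_rank_nullity[OF h(3), of ?j]
      graded_hom_rank_nullity[OF graded_hom_jacobian_map[OF f], of ?j]
    unfolding ex image_jacobian_map dim_graded_part sum_list_int by simp
qed


section \<open>Restriction to a line and logarithmic vector fields\<close>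

lemma vfield_linear_form:
  "vfield v (linear_form a) = v 0 * Const (a $ 1) + v 1 * Const (a $ 2) + v 2 * Const (a $ 3)"
  by (simp add: vfield_def partial_deriv_linear_form)

lemma linear_form_eq_0_iff [simp]: "linear_form a = 0 \<longleftrightarrow> a = 0"
proof
  assume "linear_form a = 0"
  then have "Const (a $ i) = 0" for i
    using partial_deriv_linear_form[of i a] by simp
  then show "a = 0" by (simp add: vec_eq_iff)
qed (simp add: linear_form_def)

lemma dim_mult_homogeneous:
  assumes "p \<noteq> 0"
  shows "poly3.dim ((\<lambda>q. p * q) ` {q. homogeneous k q}) = hilb k"
proof -
  obtain B where B: "finite B" "{q. homogeneous k q} \<subseteq> poly3.span B"
    using poly3_finite_spanned by blast
  have "poly3.dim {q. homogeneous k q} = poly3.dim {q \<in> {q. homogeneous k q}. p * q = 0}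
     + poly3.dim ((\<lambda>q. p * q) ` {q. homogeneous k q})"
    by (rule poly3_poly3.rank_nullity_on[OF subspace_homogeneous B])
       (auto simp: distrib_left pscale_def mult.left_commute)
  moreover have "{q \<in> {q. homogeneous k q}. p * q = 0} = {0}"
    using assms by auto
  ultimately show ?thesis by (simp add: poly3.dim_zero dim_homogeneous)
qed

lemma degree_le_span:
  "{p :: complex poly. degree p \<le> k} \<subseteq> upoly.span ((\<lambda>i. monom 1 i) ` {..k})"
proof
  fix p :: "complex poly" assume "p \<in> {p. degree p \<le> k}"
  then have "p = (\<Sum>i\<le>k. smult (coeff p i) (monom 1 i))"
    by (simp add: smult_monom poly_as_sum_of_monoms')
  also have "\<dots> \<in> upoly.span ((\<lambda>i. monom 1 i) ` {..k})"
    by (intro upoly.span_sum upoly.span_scale upoly.span_base) auto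
  finally show "p \<in> upoly.span ((\<lambda>i. monom 1 i) ` {..k})" .
qed

lemma dim_degree_le: "upoly.dim {p :: complex poly. degree p \<le> k} = Suc k"
proof (rule upoly.dim_unique)
  let ?M = "(\<lambda>i. monom 1 i :: complex poly) ` {..k}"
  have inj: "inj (\<lambda>i. monom 1 i :: complex poly)"
    by (metis degree_monom_eq injI zero_neq_one)
  show "?M \<subseteq> {p. degree p \<le> k}" by (auto simp: degree_monom_eq)
  show "{p. degree p \<le> k} \<subseteq> upoly.span ?M" by (rule degree_le_span)
  show "upoly.independent ?M" unfolding upoly.independent_explicit_finite_subsets
  proof (intro allI impI ballI)
    fix B u b assume B: "B \<subseteq> ?M" "finite B" "(\<Sum>v\<in>B. smult (u v) v) = 0" "b \<in> B"
    then obtain m where m: "b = monom 1 m" by auto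
    have "coeff (smult (u v) v) m = (if v = b then u b else 0)" if v: "v \<in> B" for v
    proof -
      obtain n where "v = monom 1 n" using v B(1) by auto
      then show ?thesis using m by (auto simp: inj_eq[OF inj])
    qed
    then have "coeff (\<Sum>v\<in>B. smult (u v) v) m = (\<Sum>v\<in>B. if v = b then u b else 0)"
      unfolding coeff_sum by (rule sum.cong[OF refl])
    then show "u b = 0" using B by simp
  qed
  show "card ?M = Suc k"
    by (subst card_image[OF inj_on_subset[OF inj subset_UNIV]]) simp
qed

definition dot :: "complex^3 \<Rightarrow> complex^3 \<Rightarrow> complex" where
  "dot a v = (\<Sum>i\<in>UNIV. a $ i * v $ i)"

lemma dot_add: "dot a (u + v) = dot a u + dot a v"
  by (simp add: dot_def algebra_simps sum.distrib)

lemma dot_scale: "dot a (c *s v) = c * dot a v"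
  by (simp add: dot_def algebra_simps sum_distrib_left)

text \<open>This is p(u + t w) as a polynomial in t: the restriction to the line through
  \<open>u\<close> and \<open>w\<close>, dehomogenised with \<open>w\<close> as the point at
  infinity. Forms of degree k on the line thus become polynomials of degree at most k.\<close>

definition restr :: "complex^3 \<Rightarrow> complex^3 \<Rightarrow> poly3 \<Rightarrow> complex poly" where
  "restr u w = psubst (\<lambda>i. [:u $ i, w $ i:])"

lemma restr_linear_form: "restr u w (linear_form a) = [:dot a u, dot a w:]"
proof -
  have "restr u w (linear_form a) = (\<Sum>i\<in>UNIV. [:a $ i:] * [:u $ i, w $ i:])"
    by (simp add: restr_def linear_form_def psubst_sum psubst_mult psubst_Const psubst_Var)
  also have "\<dots> = [:dot a u, dot a w:]"
    by (simp add: sum_3 dot_def)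
  finally show ?thesis .
qed

lemma restr_0 [simp]: "restr u w 0 = 0"
  and restr_add: "restr u w (p + q) = restr u w p + restr u w q"
  and restr_diff: "restr u w (p - q) = restr u w p - restr u w q"
  and restr_mult: "restr u w (p * q) = restr u w p * restr u w q"
  and restr_sum: "restr u w (sum f A) = (\<Sum>x\<in>A. restr u w (f x))"
  and restr_prod: "restr u w (prod f A) = (\<Prod>x\<in>A. restr u w (f x))"
  and restr_Const: "restr u w (Const c) = [:c:]"
  by (simp_all add: restr_def psubst_add psubst_diff psubst_mult psubst_sum psubst_prod psubst_Const)

lemma restr_pscale: "restr u w (pscale c p) = smult c (restr u w p)"
  by (simp add: pscale_def restr_mult restr_Const)

lemma degree_restr: "homogeneous (int k) p \<Longrightarrow> degree (restr u w p) \<le> k"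
  unfolding restr_def by (rule degree_psubst) auto

definition indep2 :: "complex^3 \<Rightarrow> complex^3 \<Rightarrow> bool" where
  "indep2 u w \<longleftrightarrow> (\<forall>s t. s *s u + t *s w = 0 \<longrightarrow> s = 0 \<and> t = 0)"

lemma indep2_minor:
  assumes "indep2 u w"
  obtains i j where "u $ i * w $ j - u $ j * w $ i \<noteq> 0"
proof (rule ccontr)
  assume "\<not> thesis"
  with that have *: "u $ i * w $ j = u $ j * w $ i" for i j by auto
  have "w \<noteq> 0" using assms[unfolded indep2_def, rule_format, of 0 1] by auto
  then obtain j where j: "w $ j \<noteq> 0" by (auto simp: vec_eq_iff)
  have "w $ j *s u + (- (u $ j)) *s w = 0"
    using *[of _ j] by (simp add: vec_eq_iff algebra_simps)
  from assms[unfolded indep2_def, rule_format, OF this] show False using j by simp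
qed

lemma restr_surj:
  assumes "indep2 u w" "degree r \<le> k"
  obtains g where "homogeneous (int k) g" "restr u w g = r"
proof -
  obtain i j where ij: "u $ i * w $ j - u $ j * w $ i \<noteq> 0"
    using indep2_minor assms by blast
  define D where "D = u $ i * w $ j - u $ j * w $ i"
  have D: "u $ i * w $ j / D - u $ j * w $ i / D = 1"
    using ij by (simp add: D_def flip: diff_divide_distrib)
  \<comment> \<open>Cramer's rule: \<open>X\<close> and \<open>Y\<close> are linear forms
    restricting to t and to 1, so each monomial t^n lifts to a form of degree k.\<close>
  define X where "X = Const (u $ i / D) * Var j - Const (u $ j / D) * Var i"
  define Y where "Y = Const (w $ j / D) * Var i - Const (w $ i / D) * Var j"
  define g where "g = (\<Sum>n\<le>k. Const (coeff r n) * (X ^ n * Y ^ (k - n)))"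
  have hom: "homogeneous 1 X" "homogeneous 1 Y"
    by (auto simp: X_def Y_def intro!: homogeneous_diff homogeneous_Const_mult)
  have "homogeneous (int n * 1 + int (k - n) * 1) (X ^ n * Y ^ (k - n))" for n
    by (intro homogeneous_mult homogeneous_power hom)
  then have "homogeneous (int k) (X ^ n * Y ^ (k - n))" if "n \<le> k" for n
    using that by (metis le_add_diff_inverse mult.right_neutral of_nat_add)
  then have 1: "homogeneous (int k) g"
    unfolding g_def by (intro homogeneous_sum homogeneous_Const_mult) auto
  have "restr u w X = [:0, 1:]" "restr u w Y = 1"
    using D by (simp_all add: X_def Y_def restr_def psubst_diff psubst_mult psubst_Const psubst_Var
        one_pCons mult.commute)
  then have "restr u w g = (\<Sum>n\<le>k. monom (coeff r n) n)"
    unfolding g_def restr_sum restr_mult restr_Const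
    by (simp add: restr_def psubst_power monom_altdef)
  also have "\<dots> = r" using assms by (simp add: poly_as_sum_of_monoms')
  finally show ?thesis using 1 that by blast
qed

definition multiples :: "complex^3 \<Rightarrow> int \<Rightarrow> poly3 set" where
  "multiples a k = (\<lambda>q. linear_form a * q) ` {q. homogeneous (k - 1) q}"

lemma multiplesI: "homogeneous (k - 1) q \<Longrightarrow> p = linear_form a * q \<Longrightarrow> p \<in> multiples a k"
  by (auto simp: multiples_def)

lemma multiplesE:
  assumes "p \<in> multiples a k"
  obtains q where "homogeneous (k - 1) q" "p = linear_form a * q"
  using assms by (auto simp: multiples_def)

lemma multiples_homogeneous: "p \<in> multiples a k \<Longrightarrow> homogeneous k p"
  using homogeneous_mult[OF homogeneous_linear_form] by (fastforce simp: multiples_def)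

lemma subspace_multiples: "poly3.subspace (multiples a k)"
  unfolding poly3.subspace_def
proof (intro conjI ballI allI)
  show "0 \<in> multiples a k" by (rule multiplesI[of _ 0]) auto
  show "x + y \<in> multiples a k" if "x \<in> multiples a k" "y \<in> multiples a k" for x y
    using that by (auto simp: multiples_def homogeneous_add simp flip: distrib_left)
  show "pscale c x \<in> multiples a k" if x: "x \<in> multiples a k" for c x
  proof -
    obtain q where "homogeneous (k - 1) q" "x = linear_form a * q"
      using x by (rule multiplesE)
    then show ?thesis
      by (intro multiplesI[of _ "Const c * q"]) (auto simp: homogeneous_Const_mult pscale_def)
  qed
qed

definition frame :: "complex^3 \<Rightarrow> complex^3 \<Rightarrow> complex^3 \<Rightarrow> bool" where
  "frame a u w \<longleftrightarrow> a \<noteq> 0 \<and> dot a u = 0 \<and> dot a w = 0 \<and> indep2 u w"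

text \<open>A dimension count: the restriction to a line maps degree \<open>k\<close> onto a space of
  dimension \<open>k + 1\<close>, which is the difference of the Hilbert functions of \<open>S\<close> and \<open>S(-1)\<close>.\<close>

lemma multiples_iff_restr:
  assumes fr: "frame a u w"
  shows "p \<in> multiples a k \<longleftrightarrow> homogeneous k p \<and> restr u w p = 0"
proof (cases "k < 0")
  case True
  then show ?thesis
    using homogeneous_neg_degree[of k p] multiples_homogeneous[of p a k]
      poly3.subspace_0[OF subspace_multiples] by auto
next
  case False
  then obtain n where n: "k = int n" using nonneg_int_cases by (metis linorder_not_less)
  define K where "K = {p \<in> {p. homogeneous k p}. restr u w p = 0}"
  obtain B where B: "finite B" "{p. homogeneous k p} \<subseteq> poly3.span B"
    using poly3_finite_spanned by blast
  have "poly3.dim {p. homogeneous k p} = poly3.dim K + upoly.dim (restr u w ` {p. homogeneous k p})"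
    unfolding K_def by (rule poly3_upoly.rank_nullity_on[OF subspace_homogeneous B])
      (auto simp: restr_add restr_pscale)
  also have "restr u w ` {p. homogeneous k p} = {r. degree r \<le> n}"
  proof (intro set_eqI iffI)
    fix r assume "r \<in> {r :: complex poly. degree r \<le> n}"
    then show "r \<in> restr u w ` {p. homogeneous k p}"
      using restr_surj[of u w r n] fr by (auto simp: frame_def n image_iff)
  qed (auto simp: n degree_restr)
  finally have "int (hilb k) = int (poly3.dim K) + int n + 1"
    by (simp add: dim_degree_le dim_homogeneous)
  moreover have "2 * int (hilb k) = 2 * int (hilb (k - 1)) + 2 * (int n + 1)"
    by (subst (1 2) hilb_eq) (auto simp: n algebra_simps)
  ultimately have "poly3.dim K = hilb (k - 1)" by simp
  also have "\<dots> = poly3.dim (multiples a k)"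
    using fr unfolding multiples_def by (subst dim_mult_homogeneous) (auto simp: frame_def)
  finally have dim: "poly3.dim K \<le> poly3.dim (multiples a k)" by simp
  have "multiples a k \<subseteq> K"
  proof
    fix q assume q: "q \<in> multiples a k"
    then have "restr u w q = 0"
      using fr by (auto simp: restr_mult restr_linear_form frame_def elim!: multiplesE)
    then show "q \<in> K" using q multiples_homogeneous by (auto simp: K_def)
  qed
  moreover have "K \<subseteq> poly3.span B" using B by (auto simp: K_def)
  ultimately have "multiples a k = K"
    using poly3.subspace_dim_equal_on[OF subspace_multiples _ B(1) _ dim] by blast
  then show ?thesis by (auto simp: K_def)
qed

text \<open>The normal vectors \<open>a\<close> are a parameter, so that all subarrangements share
  the same linear forms when lines are added one by one.\<close>

definition arrangement :: "(complex^3) set set \<Rightarrow> ((complex^3) set \<Rightarrow> complex^3) \<Rightarrow> bool" where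
  "arrangement A a \<longleftrightarrow> line_arrangement A \<and> (\<forall>L\<in>A. L = {v. dot (a L) v = 0})"

lemma arrangement_subset: "arrangement A a \<Longrightarrow> B \<subseteq> A \<Longrightarrow> arrangement B a"
  unfolding arrangement_def line_arrangement_def by (meson finite_subset in_mono)

lemma proj_line_basis:
  assumes "proj_line L"
  obtains u w where "indep2 u w" "L = {s *s u + t *s w | s t. True}"
proof -
  obtain B where B: "B \<subseteq> L" "vec.independent B" "L \<subseteq> vec.span B" "card B = 2"
    using vec.basis_exists[of L] assms by (auto simp: proj_line_def)
  obtain u w where uw: "B = {u, w}" "u \<noteq> w" using B(4) by (auto simp: card_2_iff)
  have ind: "u \<notin> vec.span {w}" "w \<noteq> 0"
    using B(2) uw by (auto simp: vec.independent_insert)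
  have "s = 0 \<and> t = 0" if st: "s *s u + t *s w = 0" for s t
  proof -
    have "s = 0"
    proof (rule ccontr)
      assume s: "s \<noteq> 0"
      have "u = (- t / s) *s w"
        using s st by (simp add: vec_eq_iff field_simps add_eq_0_iff2)
      then show False using ind vec.span_scale[OF vec.span_base[of w "{w}"]] by (metis insertI1)
    qed
    moreover have "t *s w = 0" using st \<open>s = 0\<close> by simp
    ultimately show ?thesis using ind by (simp only: vec.scale_eq_0_iff) simp
  qed
  then have "indep2 u w" by (auto simp: indep2_def)
  moreover have "L = {s *s u + t *s w | s t. True}"
  proof
    show "L \<subseteq> {s *s u + t *s w | s t. True}"
    proof
      fix x assume "x \<in> L"
      then have "x \<in> vec.span {u, w}" using B uw by auto
      then obtain s where "x - s *s u \<in> vec.span {w}" using vec.span_breakdown_eq[of x u] by auto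
      then obtain t where "x - s *s u - t *s w \<in> vec.span {}" using vec.span_breakdown_eq[of _ w] by auto
      then have "x = s *s u + t *s w" by (simp add: vec.span_empty algebra_simps)
      then show "x \<in> {s *s u + t *s w | s t. True}" by blast
    qed
    have "vec.subspace L" using assms by (auto simp: proj_line_def)
    then show "{s *s u + t *s w | s t. True} \<subseteq> L"
      using B uw by (auto intro!: vec.subspace_add vec.subspace_scale)
  qed
  ultimately show ?thesis using that by blast
qed

context
  fixes A a
  assumes arr: "arrangement A a"
begin

lemma arrangement_line: "L \<in> A \<Longrightarrow> L = {v. dot (a L) v = 0}" "L \<in> A \<Longrightarrow> proj_line L"
  using arr unfolding arrangement_def line_arrangement_def by blast+

lemma arrangement_nonzero: "L \<in> A \<Longrightarrow> a L \<noteq> 0"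
proof
  assume L: "L \<in> A" "a L = 0"
  then have "L = UNIV" using arrangement_line(1)[OF L(1)] by (auto simp: dot_def)
  moreover have "vec.dim (UNIV :: (complex^3) set) = 3"
    by (subst vec_dim_card) simp
  ultimately have "(3::nat) = 2" using arrangement_line(2)[OF L(1)] unfolding proj_line_def by (simp only:)
  then show False by simp
qed

lemma arrangement_frame:
  assumes "L \<in> A"
  obtains u w where "frame (a L) u w" "L = {s *s u + t *s w | s t. True}"
proof -
  obtain u w where uw: "indep2 u w" "L = {s *s u + t *s w | s t. True}"
    using proj_line_basis arrangement_line(2)[OF assms] .
  have "u = 1 *s u + 0 *s w" "w = 0 *s u + 1 *s w" by (simp_all add: vec_eq_iff)
  then have "u \<in> L" "w \<in> L" unfolding uw(2) by blast+
  then have "dot (a L) u = 0" "dot (a L) w = 0" using arrangement_line(1)[OF assms] by auto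
  then show ?thesis using that uw arrangement_nonzero[OF assms] by (auto simp: frame_def)
qed

lemma arrangement_not_subset:
  assumes "L \<in> A" "L' \<in> A" "L \<noteq> L'"
  obtains v where "v \<in> L" "v \<notin> L'"
proof (rule ccontr)
  assume "\<not> thesis"
  with that have "L \<subseteq> L'" by blast
  then have "L = L'" 
    using arrangement_line(2) assms by (intro vec.subspace_dim_equal) (auto simp: proj_line_def)
  with assms show False by simp
qed

text \<open>If the form of \<open>L'\<close> vanished on \<open>L\<close>, then \<open>L\<close>
  would be contained in \<open>L'\<close>, which is impossible for distinct subspaces of dimension
  2.\<close>

lemma restr_other_form:
  assumes "L \<in> A" "L' \<in> A" "L \<noteq> L'" and uw: "L = {s *s u + t *s w | s t. True}"
  shows "restr u w (linear_form (a L')) \<noteq> 0"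
proof
  assume 0: "restr u w (linear_form (a L')) = 0"
  obtain v where v: "v \<in> L" "v \<notin> L'" using arrangement_not_subset assms by blast
  then obtain s t where "v = s *s u + t *s w" using uw by blast
  then have "dot (a L') v = 0" using 0 by (simp add: restr_linear_form dot_add dot_scale)
  then show False using v arrangement_line(1)[OF assms(2)] by blast
qed

text \<open>The forms of distinct lines are coprime. They are split off one at a time: on the next
  line \<open>L\<close> the forms already removed restrict to nonzero elements of the domain C[t],
  so it is the cofactor that vanishes on \<open>L\<close>.\<close>

lemma prod_forms_dvd:
  assumes "M \<subseteq> A" "homogeneous k p" "\<And>L. L \<in> M \<Longrightarrow> p \<in> multiples (a L) k"
  shows "\<exists>q. homogeneous (k - int (card M)) q \<and> p = (\<Prod>L\<in>M. linear_form (a L)) * q"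
proof -
  have "finite M" using assms(1) arr finite_subset by (auto simp: arrangement_def line_arrangement_def)
  then show ?thesis using assms(1,3)
  proof (induction M rule: finite_induct)
    case empty
    then show ?case using assms(2) by simp
  next
    case (insert L M)
    then obtain q where q: "homogeneous (k - int (card M)) q" "p = (\<Prod>L\<in>M. linear_form (a L)) * q"
      by auto
    obtain u w where uw: "frame (a L) u w" "L = {s *s u + t *s w | s t. True}"
      using arrangement_frame[of L] insert by blast
    have "restr u w p = 0" using insert.prems multiples_iff_restr[OF uw(1)] by blast
    moreover have "restr u w (linear_form (a L')) \<noteq> 0" if "L' \<in> M" for L'
      using restr_other_form[OF _ _ _ uw(2), of L'] insert that by auto
    ultimately have "restr u w q = 0"
      using q insert.hyps by (auto simp: restr_mult restr_prod)
    then have "q \<in> multiples (a L) (k - int (card M))"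
      using multiples_iff_restr[OF uw(1)] q by blast
    then obtain q' where q': "homogeneous (k - int (card M) - 1) q'" "q = linear_form (a L) * q'"
      by (rule multiplesE)
    have "homogeneous (k - int (card (insert L M))) q'"
      using q'(1) insert.hyps by (simp add: algebra_simps)
    moreover have "p = (\<Prod>L\<in>insert L M. linear_form (a L)) * q'"
      unfolding q(2) q'(2) prod.insert[OF insert.hyps] by (simp only: mult_ac)
    ultimately show ?case by blast
  qed
qed

end

section \<open>Logarithmic vector fields and their relation to syzygies\<close>

definition log_fields :: "(complex^3) set set \<Rightarrow> ((complex^3) set \<Rightarrow> complex^3) \<Rightarrow> int \<Rightarrow> (nat \<Rightarrow> poly3) set" where
  "log_fields A a k =
     {v \<in> graded_part (replicate 3 0) k. \<forall>L\<in>A. vfield v (linear_form (a L)) \<in> multiples (a L) k}"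

lemma subspace_log_fields: "fmod.subspace (log_fields A a k)"
  using fmod.subspace_0[OF subspace_graded_part] fmod.subspace_add[OF subspace_graded_part]
    fmod.subspace_scale[OF subspace_graded_part]
    poly3.subspace_0[OF subspace_multiples] poly3.subspace_add[OF subspace_multiples]
    poly3.subspace_scale[OF subspace_multiples]
  by (auto simp: log_fields_def fmod.subspace_def vfield_add vfield_scale vfield_def[of 0])

lemma vfield_1 [simp]: "vfield v 1 = 0"
  using partial_deriv_Const[of _ 1] by (simp add: vfield_def)

lemma vfield_prod:
  "finite A \<Longrightarrow> vfield v (prod f A) = (\<Sum>x\<in>A. vfield v (f x) * prod f (A - {x}))"
proof (induction A rule: finite_induct)
  case (insert x A)
  have "prod f (insert x A - {y}) = f x * prod f (A - {y})" if "y \<in> A" for y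
  proof -
    have "insert x A - {y} = insert x (A - {y})" using insert that by auto
    then show ?thesis using insert by simp
  qed
  then have "(\<Sum>y\<in>A. vfield v (f y) * prod f (insert x A - {y})) = f x * vfield v (prod f A)"
    unfolding insert.IH sum_distrib_left by (intro sum.cong refl) (simp only: mult_ac)
  then show ?case using insert.hyps by (simp add: vfield_mult add.commute mult.commute)
qed simp

lemma vfield_graded:
  "v \<in> graded_part (replicate 3 0) k \<Longrightarrow> homogeneous k (vfield v (linear_form a))"
  using homogeneous_vfield[of 1 "linear_form a" k v] by (simp add: graded_part_def)

text \<open>Rank-nullity for \<theta> \<mapsto> \<theta>(f) on logarithmic fields. Two points carry
  it: a field that annihilates f is logarithmic, and the image consists of all multiples of f, where
  the cofactor \<theta>(f) / f has degree k - 1.\<close>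

lemma dim_log_fields_syzygies:
  assumes arr: "arrangement A a" and ne: "A \<noteq> {}" and f: "f = (\<Prod>L\<in>A. linear_form (a L))"
  shows "fmod.dim (log_fields A a k) = fmod.dim (syzygies f k) + hilb (k - 1)"
proof -
  have fin: "finite A" using arr by (simp add: arrangement_def line_arrangement_def)
  obtain B where B: "finite B" "graded_part (replicate 3 0) k \<subseteq> fmod.span B"
    using graded_part_finite_spanned .
  have B': "log_fields A a k \<subseteq> fmod.span B" using B(2) by (auto simp: log_fields_def)
  have f0: "f \<noteq> 0" using arrangement_nonzero[OF arr] fin by (auto simp: f)
  have split: "f = linear_form (a L) * (\<Prod>L'\<in>A - {L}. linear_form (a L'))" if "L \<in> A" for L
    unfolding f by (rule prod.remove[OF fin that])
  \<comment> \<open>The logarithmic derivative: \<theta>(f) / f is the sum of the quotients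
    \<theta>(\<alpha>) / \<alpha> over the forms of the lines.\<close>
  have vf: "vfield v f = f * sum g A" if g: "\<And>L. L \<in> A \<Longrightarrow> vfield v (linear_form (a L)) = linear_form (a L) * g L" for v g
  proof -
    have "vfield v (linear_form (a L)) * (\<Prod>L'\<in>A - {L}. linear_form (a L')) = f * g L" if "L \<in> A" for L
      by (subst split[OF that]) (simp only: g[OF that] mult_ac)
    then show ?thesis unfolding f vfield_prod[OF fin] by (simp add: sum_distrib_left flip: f)
  qed
  have "fmod.dim (log_fields A a k) = fmod.dim {v \<in> log_fields A a k. vfield v f = 0}
      + poly3.dim ((\<lambda>v. vfield v f) ` log_fields A a k)"
    by (rule fmod_poly3.rank_nullity_on[OF subspace_log_fields B(1) B'])
       (auto simp: vfield_add vfield_scale)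
  also have "{v \<in> log_fields A a k. vfield v f = 0} = syzygies f k"
  proof
    show "syzygies f k \<subseteq> {v \<in> log_fields A a k. vfield v f = 0}"
    proof
      fix v assume v: "v \<in> syzygies f k"
      have "vfield v (linear_form (a L)) \<in> multiples (a L) k" if L: "L \<in> A" for L
      proof -
        obtain u w where uw: "frame (a L) u w" "L = {s *s u + t *s w | s t. True}"
          using arrangement_frame[OF arr L] .
        have L0: "restr u w (linear_form (a L)) = 0"
          using uw(1) by (simp add: restr_linear_form frame_def)
        \<comment> \<open>In the product rule for f every term except that of \<open>L\<close>
          contains the form of \<open>L\<close> and vanishes on \<open>L\<close>. The other forms do
          not, so \<theta>(f) = 0 leaves \<theta>(\<alpha>) = 0 on \<open>L\<close>.\<close>
        have "restr u w (prod (\<lambda>L. linear_form (a L)) (A - {L'})) = 0" if "L' \<noteq> L" for L'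
          using that fin L L0 by (auto simp: restr_prod)
        then have "restr u w (vfield v f) = 
          (\<Sum>L'\<in>A. if L' = L then restr u w (vfield v (linear_form (a L)) * prod (\<lambda>L. linear_form (a L)) (A - {L})) else 0)"
          unfolding f vfield_prod[OF fin] restr_sum by (intro sum.cong) (auto simp: restr_mult)
        then have "restr u w (vfield v (linear_form (a L))) * (\<Prod>L\<in>A - {L}. restr u w (linear_form (a L))) = 0"
          using v fin L by (simp add: syzygies_def restr_mult restr_prod)
        moreover have "(\<Prod>L\<in>A - {L}. restr u w (linear_form (a L))) \<noteq> 0"
          using restr_other_form[OF arr L _ _ uw(2)] fin by auto
        ultimately show ?thesis
          using v vfield_graded by (auto simp: multiples_iff_restr[OF uw(1)] syzygies_def)
      qed
      then show "v \<in> {v \<in> log_fields A a k. vfield v f = 0}"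
        using v by (auto simp: log_fields_def syzygies_def)
    qed
  qed (auto simp: log_fields_def syzygies_def)
  also have "(\<lambda>v. vfield v f) ` log_fields A a k = (\<lambda>q. f * q) ` {q. homogeneous (k - 1) q}"
  proof (intro set_eqI iffI)
    fix p assume "p \<in> (\<lambda>v. vfield v f) ` log_fields A a k"
    then obtain v where v: "p = vfield v f" "v \<in> log_fields A a k" by blast
    then have "\<forall>L\<in>A. \<exists>q. homogeneous (k - 1) q \<and> vfield v (linear_form (a L)) = linear_form (a L) * q"
      by (auto simp: log_fields_def multiples_def)
    then obtain g where g: "\<And>L. L \<in> A \<Longrightarrow> homogeneous (k - 1) (g L)"
      "\<And>L. L \<in> A \<Longrightarrow> vfield v (linear_form (a L)) = linear_form (a L) * g L" by metis
    have "p = f * sum g A" using vf[OF g(2)] v by simp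
    then show "p \<in> (\<lambda>q. f * q) ` {q. homogeneous (k - 1) q}"
      by (rule image_eqI) (simp add: homogeneous_sum g(1))
  next
    fix p assume "p \<in> (\<lambda>q. f * q) ` {q. homogeneous (k - 1) q}"
    then obtain q where q: "p = f * q" "homogeneous (k - 1) q" by blast
    \<comment> \<open>The preimage of f q is the Euler field times c q. The Euler field reproduces
      every linear form and therefore multiplies f by the number of lines, which \<open>c\<close>
      cancels.\<close>
    define c where "c = inverse (of_nat (card A) :: complex)"
    have c: "of_nat (card A) * c = 1" using ne fin by (simp add: c_def)
    define v where "v i = (if i = 0 then q * (Const c * Var 1) else if i = 1 then q * (Const c * Var 2)
      else if i = 2 then q * (Const c * Var 3) else 0)" for i :: nat
    have vL: "vfield v (linear_form b) = linear_form b * (Const c * q)" for b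
    proof -
      have "v 0 = q * (Const c * Var 1)" "v 1 = q * (Const c * Var 2)" "v 2 = q * (Const c * Var 3)"
        by (simp_all add: v_def)
      then show ?thesis
        unfolding vfield_linear_form unfolding linear_form_def sum_3
        by (simp only: distrib_left distrib_right mult_ac)
    qed
    have "homogeneous (k - 1 + 1) (q * (Const c * Var i))" for i
      by (intro homogeneous_mult homogeneous_Const_mult q) simp
    then have "v \<in> graded_part (replicate 3 0) k"
      by (auto simp: graded_part_def free_module_def v_def)
    moreover have "vfield v (linear_form b) \<in> multiples b k" for b
      by (rule multiplesI[OF _ vL]) (use q homogeneous_Const_mult in simp)
    ultimately have "v \<in> log_fields A a k" by (simp add: log_fields_def)
    moreover have "vfield v f = p"
    proof -
      have "vfield v f = f * (\<Sum>L\<in>A. Const c * q)" by (rule vf) (rule vL)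
      also have "(\<Sum>L\<in>A. Const c * q) = Const (of_nat (card A) * c) * q"
        by (simp add: Const_mult) (simp add: Const_def flip: of_nat_single)
      finally show ?thesis using c q by simp
    qed
    ultimately show "p \<in> (\<lambda>v. vfield v f) ` log_fields A a k" by blast
  qed
  also have "poly3.dim \<dots> = hilb (k - 1)" by (rule dim_mult_homogeneous[OF f0])
  finally show ?thesis .
qed


section \<open>Adding a line to an arrangement\<close>

lemma dim_mult_degree_le:
  assumes "b \<noteq> (0 :: complex poly)"
  shows "upoly.dim ((\<lambda>r. b * r) ` {r. degree r \<le> k}) = Suc k"
proof -
  have "upoly.subspace {p :: complex poly. degree p \<le> k}"
    by (auto simp: upoly.subspace_def intro: degree_add_le order.trans[OF degree_smult_le])
  from upoly_upoly.rank_nullity_on[OF this _ degree_le_span, of "\<lambda>r. b * r"]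
  have "upoly.dim {p :: complex poly. degree p \<le> k} = upoly.dim {r \<in> {r. degree r \<le> k}. b * r = 0}
     + upoly.dim ((\<lambda>r. b * r) ` {r. degree r \<le> k})"
    by (simp add: distrib_left)
  moreover have "{r \<in> {r. degree r \<le> k}. b * r = 0} = {0}"
    using assms by auto
  ultimately show ?thesis by (simp add: upoly.dim_zero dim_degree_le)
qed

text \<open>The product over the other roots has order 0 at \<open>\<tau>\<close>, so the full order
  of \<open>p\<close> at \<open>\<tau>\<close> sits in the cofactor.\<close>

lemma prod_powers_dvd:
  fixes p :: "complex poly"
  assumes "finite T" "\<And>\<tau>. \<tau> \<in> T \<Longrightarrow> [:- \<tau>, 1:] ^ e \<tau> dvd p"
  shows "(\<Prod>\<tau>\<in>T. [:- \<tau>, 1:] ^ e \<tau>) dvd p"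
  using assms
proof (induction T rule: finite_induct)
  case (insert \<tau> T)
  show ?case
  proof (cases "p = 0")
    case False
    let ?P = "\<Prod>\<tau>\<in>T. [:- \<tau>, 1:] ^ e \<tau>"
    have "?P dvd p" using insert.IH insert.prems by blast
    then obtain q where q: "p = ?P * q" by (rule dvdE)
    have "poly ?P \<tau> \<noteq> 0" using insert.hyps by (auto simp: poly_prod poly_power)
    then have "order \<tau> p = order \<tau> q" using False q by (simp add: order_mult order_0I)
    then have "e \<tau> \<le> order \<tau> q" using insert.prems[of \<tau>] False by (simp add: order_divides)
    then have "[:- \<tau>, 1:] ^ e \<tau> dvd q" by (simp add: order_divides)
    then show ?thesis using insert.hyps q by (simp add: mult.commute mult_dvd_mono)
  qed simp
qed simp

text \<open>Lagrange interpolation without a bound on the degree of \<open>r\<close> by the number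
  of nodes. The products have degree card T - 1, so the coefficients get the remaining degree. It
  splits a prescribed restriction to H into contributions of single intersection points.\<close>

lemma lagrange_combination:
  fixes r :: "complex poly"
  assumes "finite T" "T \<noteq> {}" "degree r \<le> k" "card T \<le> Suc k"
  shows "\<exists>g. (\<forall>\<tau>. degree (g \<tau>) \<le> Suc k - card T) \<and>
    r = (\<Sum>\<tau>\<in>T. g \<tau> * (\<Prod>\<sigma>\<in>T - {\<tau>}. [:- \<sigma>, 1:]))"
  using assms
proof (induction T arbitrary: r k rule: finite_ne_induct)
  case (singleton \<tau>)
  then show ?case by (intro exI[of _ "\<lambda>_. r"]) auto
next
  case (insert \<tau> T)
  define P where "P = (\<Prod>\<sigma>\<in>T. [:- \<sigma>, 1:])"
  \<comment> \<open>A constant multiple of \<open>P\<close>, the product that omits the new node,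
    corrects the value at \<open>\<tau>\<close>; the rest is divisible by t - \<tau>, and the
    quotient goes to the induction hypothesis.\<close>
  define c where "c = poly r \<tau> / poly P \<tau>"
  have T: "0 < card T" using insert by (simp add: card_gt_0_iff)
  have k: "Suc (card T) \<le> Suc k" using insert by simp
  have "degree P = card T"
    unfolding P_def by (subst degree_prod_eq_sum_degree) auto
  then have d: "degree (r - smult c P) \<le> k"
    using k insert.prems by (intro degree_diff_le order.trans[OF degree_smult_le]) auto
  have "poly P \<tau> \<noteq> 0" using insert.hyps by (auto simp: P_def poly_prod)
  then have "poly (r - smult c P) \<tau> = 0" by (simp add: c_def)
  then have "[:- \<tau>, 1:] dvd r - smult c P" by (simp only: poly_eq_0_iff_dvd)
  then obtain r1 where r1: "r - smult c P = [:- \<tau>, 1:] * r1" by (rule dvdE)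
  have "degree r1 \<le> k - 1"
  proof (cases "r1 = 0")
    case False
    then have "degree (r - smult c P) = Suc (degree r1)" 
      unfolding r1 by (subst degree_mult_eq) auto
    then show ?thesis using d by simp
  qed simp
  from insert.IH[OF this] k T obtain g where g: "\<And>\<tau>. degree (g \<tau>) \<le> Suc (k - 1) - card T"
    "r1 = (\<Sum>\<tau>\<in>T. g \<tau> * (\<Prod>\<sigma>\<in>T - {\<tau>}. [:- \<sigma>, 1:]))" by auto
  define g' where "g' \<sigma> = (if \<sigma> = \<tau> then [:c:] else g \<sigma>)" for \<sigma>
  have "(\<Sum>\<rho>\<in>insert \<tau> T. g' \<rho> * (\<Prod>\<sigma>\<in>insert \<tau> T - {\<rho>}. [:- \<sigma>, 1:]))
    = smult c P + (\<Sum>\<rho>\<in>T. g' \<rho> * (\<Prod>\<sigma>\<in>insert \<tau> T - {\<rho>}. [:- \<sigma>, 1:]))"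
    using insert.hyps by (simp add: g'_def P_def)
  also have "(\<Sum>\<rho>\<in>T. g' \<rho> * (\<Prod>\<sigma>\<in>insert \<tau> T - {\<rho>}. [:- \<sigma>, 1:])) = [:- \<tau>, 1:] * r1"
    unfolding g(2) sum_distrib_left
  proof (rule sum.cong[OF refl])
    fix \<rho> assume \<rho>: "\<rho> \<in> T"
    then have "insert \<tau> T - {\<rho>} = insert \<tau> (T - {\<rho>})" "g' \<rho> = g \<rho>"
      using insert.hyps by (auto simp: g'_def)
    moreover have "(\<Prod>\<sigma>\<in>insert \<tau> (T - {\<rho>}). [:- \<sigma>, 1:]) = [:- \<tau>, 1:] * (\<Prod>\<sigma>\<in>T - {\<rho>}. [:- \<sigma>, 1:])"
      using insert.hyps by (intro prod.insert) auto
    ultimately show "g' \<rho> * (\<Prod>\<sigma>\<in>insert \<tau> T - {\<rho>}. [:- \<sigma>, 1:])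
      = [:- \<tau>, 1:] * (g \<rho> * (\<Prod>\<sigma>\<in>T - {\<rho>}. [:- \<sigma>, 1:]))"
      by (simp only: mult.left_commute)
  qed
  finally have E: "(\<Sum>\<rho>\<in>insert \<tau> T. g' \<rho> * (\<Prod>\<sigma>\<in>insert \<tau> T - {\<rho>}. [:- \<sigma>, 1:])) = smult c P + (r - smult c P)"
    unfolding r1 .
  then have "r = (\<Sum>\<rho>\<in>insert \<tau> T. g' \<rho> * (\<Prod>\<sigma>\<in>insert \<tau> T - {\<rho>}. [:- \<sigma>, 1:]))"
    unfolding E by simp
  moreover have "degree (g' \<rho>) \<le> Suc k - card (insert \<tau> T)" for \<rho>
    using g(1)[of \<rho>] insert.hyps k T by (auto simp: g'_def)
  ultimately show ?case by blast
qed

lemma homogeneous_0_Const: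
  assumes "homogeneous 0 p"
  obtains c where "p = Const c"
proof
  show "p = Const (Poly_Mapping.lookup p 0)"
  proof (rule poly_mapping_eqI)
    fix m
    have "m = 0" if "mono_degree m = 0"
      using that by (intro poly_mapping_eqI) (simp add: mono_degree_def)
    then show "Poly_Mapping.lookup p m = Poly_Mapping.lookup (Const (Poly_Mapping.lookup p 0)) m"
      using assms by (cases "m = 0") (auto simp: homogeneous_iff Const_def lookup_single when_def)
  qed
qed

text \<open>The derivative in the constant direction \<open>x\<close>, multiplied by
  \<open>h\<close>. It annihilates the forms of the lines through \<open>x\<close>, and for the
  other lines it is logarithmic as soon as their forms divide \<open>h\<close>.\<close>

definition const_field :: "poly3 \<Rightarrow> complex^3 \<Rightarrow> nat \<Rightarrow> poly3" where
  "const_field h x i = (if i = 0 then h * Const (x $ 1) else if i = 1 then h * Const (x $ 2)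
      else if i = 2 then h * Const (x $ 3) else 0)"

lemma const_field_graded:
  assumes "homogeneous k h" shows "const_field h x \<in> graded_part (replicate 3 0) k"
proof -
  have "homogeneous k (h * Const c)" for c
    using homogeneous_mult[OF assms homogeneous_Const] by simp
  then show ?thesis by (auto simp: graded_part_def free_module_def const_field_def)
qed

lemma vfield_const_field: "vfield (const_field h x) (linear_form b) = h * Const (dot b x)"
proof -
  have "const_field h x 0 = h * Const (x $ 1)" "const_field h x 1 = h * Const (x $ 2)"
    "const_field h x 2 = h * Const (x $ 3)" by (simp_all add: const_field_def)
  then show ?thesis
    unfolding vfield_linear_form dot_def sum_3 Const_add Const_mult
    by (simp only: distrib_left mult_ac)
qed

lemma vfield_zero: "vfield 0 p = 0"
  by (simp add: vfield_def)

lemma vfield_add_right: "vfield v (p + q) = vfield v p + vfield v q"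
  by (simp add: vfield_def partial_deriv_add algebra_simps)

lemma vfield_Const_mult: "vfield v (Const c * p) = Const c * vfield v p"
  by (simp add: vfield_mult) (simp add: vfield_def)

lemma vfield_sum: "vfield (sum v A) p = (\<Sum>x\<in>A. vfield (v x) p)"
  by (induction A rule: infinite_finite_induct)
     (simp_all only: sum.infinite sum.empty sum.insert vfield_add vfield_zero not_False_eq_True)

section \<open>Restricting logarithmic fields to an added line\<close>

context
  fixes A a H u w
  assumes arr: "arrangement (insert H A) a" and H: "H \<notin> A"
    and fr: "frame (a H) u w" and gen: "\<And>L. L \<in> A \<Longrightarrow> dot (a L) w \<noteq> 0"
begin

lemma arr_A: "arrangement A a"
  using arrangement_subset[OF arr] by blast

lemma finite_A: "finite A"
  using arr_A by (simp add: arrangement_def line_arrangement_def)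

lemma restr_H: "restr u w (linear_form (a H)) = 0"
  using fr by (simp add: restr_linear_form frame_def)

text \<open>The parameter of the intersection with H, which is spanned by u + meet L w. It is finite
  for every line because \<open>w\<close> lies on none of them.\<close>

definition meet :: "(complex^3) set \<Rightarrow> complex" where
  "meet L = - dot (a L) u / dot (a L) w"

lemma restr_form: "L \<in> A \<Longrightarrow> restr u w (linear_form (a L)) = smult (dot (a L) w) [:- meet L, 1:]"
  using gen by (simp add: restr_linear_form meet_def)

definition mult_at :: "complex \<Rightarrow> nat" where
  "mult_at \<tau> = card {L \<in> A. meet L = \<tau>}"

text \<open>The dehomogenised form of degree m - n from the overview, known from the theory of
  addition and deletion of hyperplanes as the polynomial B with \<theta>(\<alpha>) in the ideal
  generated by \<alpha> and B, where \<alpha> is the form of H.\<close>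

definition ram :: "complex poly" where
  "ram = (\<Prod>\<tau>\<in>meet ` A. [:- \<tau>, 1:] ^ (mult_at \<tau> - 1))"

lemma mult_at_pos: "\<tau> \<in> meet ` A \<Longrightarrow> 0 < mult_at \<tau>"
  using finite_A by (auto simp: mult_at_def card_gt_0_iff)

lemma ram_nonzero: "ram \<noteq> 0"
  using finite_A by (auto simp: ram_def)

lemma ram_times: "(\<Prod>L\<in>A. [:- meet L, 1:]) = ram * (\<Prod>\<tau>\<in>meet ` A. [:- \<tau>, 1:])"
proof -
  have "(\<Prod>L\<in>A. [:- meet L, 1:]) = (\<Prod>\<tau>\<in>meet ` A. \<Prod>L\<in>{L \<in> A. meet L = \<tau>}. [:- meet L, 1:])"
    by (rule prod.image_gen[OF finite_A])
  also have "\<dots> = (\<Prod>\<tau>\<in>meet ` A. [:- \<tau>, 1:] ^ mult_at \<tau>)"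
    by (rule prod.cong) (auto simp: mult_at_def)
  also have "\<dots> = (\<Prod>\<tau>\<in>meet ` A. [:- \<tau>, 1:] ^ (mult_at \<tau> - 1) * [:- \<tau>, 1:])"
    by (rule prod.cong[OF refl]) (rule power_minus_mult[OF mult_at_pos, symmetric])
  finally show ?thesis by (simp only: ram_def prod.distrib)
qed

lemma degree_ram: "degree ram + card (meet ` A) = card A"
proof -
  have "degree (\<Prod>L\<in>A. [:- meet L, 1:]) = card A"
    by (subst degree_prod_eq_sum_degree) auto
  moreover have "degree (\<Prod>\<tau>\<in>meet ` A. [:- \<tau>, 1:]) = card (meet ` A)"
    by (subst degree_prod_eq_sum_degree) auto
  moreover have "(\<Prod>\<tau>\<in>meet ` A. [:- \<tau>, 1:]) \<noteq> 0" using finite_A by auto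
  ultimately show ?thesis
    using ram_nonzero by (simp add: ram_times degree_mult_eq)
qed

text \<open>Lines through a common point of H belong to the pencil spanned by H and one of them:
  with \<open>b\<close> matching the restrictions, the difference has degree 1 and vanishes on H, so
  it is a constant times the form of H.\<close>

lemma form_combination:
  assumes L: "L \<in> A" "L' \<in> A" "meet L = meet L'"
  obtains b c where "b \<noteq> 0" "linear_form (a L) = Const b * linear_form (a L') + Const c * linear_form (a H)"
proof -
  define b where "b = dot (a L) w / dot (a L') w"
  have "b \<noteq> 0" using L gen by (simp add: b_def)
  have "homogeneous 1 (linear_form (a L) - Const b * linear_form (a L'))"
    by (intro homogeneous_diff homogeneous_Const_mult) auto
  moreover have "restr u w (linear_form (a L) - Const b * linear_form (a L')) = 0"
    using L gen by (simp add: restr_diff restr_mult restr_Const restr_form b_def)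
  ultimately have "linear_form (a L) - Const b * linear_form (a L') \<in> multiples (a H) 1"
    using multiples_iff_restr[OF fr] by blast
  then obtain q where q: "homogeneous (1 - 1) q" "linear_form (a L) - Const b * linear_form (a L') = linear_form (a H) * q"
    by (rule multiplesE)
  obtain c where "q = Const c" using q(1) homogeneous_0_Const by auto
  then have "linear_form (a L) = Const b * linear_form (a L') + Const c * linear_form (a H)"
    using q(2) by (metis add.commute diff_add_cancel mult.commute)
  then show ?thesis using that \<open>b \<noteq> 0\<close> by blast
qed

text \<open>Writing \<open>\<alpha>\<close> for the form of \<open>H\<close> and \<open>\<beta>\<close> for the form of one of the \<open>m\<close> lines of \<open>A\<close> through a
  point of \<open>H\<close>, the polynomial \<open>\<theta>(\<alpha>) \<beta> - \<theta>(\<beta>) \<alpha>\<close> does not change, up to a scalar, if \<open>\<beta>\<close> is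
  replaced by the form of another of these lines; so it is divisible by all \<open>m\<close> forms.\<close>

lemma power_dvd_restr:
  assumes v: "v \<in> log_fields A a k" and \<tau>: "\<tau> \<in> meet ` A"
  shows "[:- \<tau>, 1:] ^ (mult_at \<tau> - 1) dvd restr u w (vfield v (linear_form (a H)))"
proof -
  define M where "M = {L \<in> A. meet L = \<tau>}"
  obtain L' where L': "L' \<in> A" "meet L' = \<tau>" using \<tau> by blast
  let ?\<alpha> = "linear_form (a H)" and ?\<beta> = "linear_form (a L')"
  define p where "p = vfield v ?\<alpha>"
  define q where "q = vfield v ?\<beta>"
  have gr: "v \<in> graded_part (replicate 3 0) k" using v by (simp add: log_fields_def)
  define F where "F = p * ?\<beta> - q * ?\<alpha>"
  have hom: "homogeneous k p" "homogeneous k q" using gr by (auto simp: p_def q_def vfield_graded)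
  then have homF: "homogeneous (k + 1) F"
    unfolding F_def by (intro homogeneous_diff homogeneous_mult) auto
  have "F \<in> multiples (a L) (k + 1)" if L: "L \<in> M" for L
  proof -
    obtain b c where bc: "b \<noteq> 0" "linear_form (a L) = Const b * ?\<beta> + Const c * ?\<alpha>"
      using form_combination[of L L'] L L' by (auto simp: M_def)
    obtain g where g: "homogeneous (k - 1) g" "vfield v (linear_form (a L)) = linear_form (a L) * g"
      using v L by (auto simp: log_fields_def M_def elim: multiplesE)
    have vL: "vfield v (linear_form (a L)) = Const b * q + Const c * p"
      unfolding bc(2) p_def q_def by (simp only: vfield_add_right vfield_Const_mult)
    have "Const b * F = p * linear_form (a L) - ?\<alpha> * vfield v (linear_form (a L))"
      unfolding vL unfolding F_def bc(2)
      by (simp only: distrib_left right_diff_distrib mult_ac add_diff_cancel_right)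
    also have "\<dots> = linear_form (a L) * (p - ?\<alpha> * g)"
      unfolding g(2) by (simp only: right_diff_distrib mult_ac)
    finally have "Const (inverse b) * (Const b * F) = linear_form (a L) * (Const (inverse b) * (p - ?\<alpha> * g))"
      by (simp only: mult_ac)
    moreover have "Const (inverse b) * (Const b * F) = F"
      using bc(1) by (simp flip: mult.assoc Const_mult)
    moreover have "homogeneous (1 + (k - 1)) (?\<alpha> * g)"
      by (intro homogeneous_mult g) simp
    then have "homogeneous (k + 1 - 1) (Const (inverse b) * (p - ?\<alpha> * g))"
      using hom by (intro homogeneous_Const_mult homogeneous_diff) auto
    ultimately show ?thesis using multiplesI by metis
  qed
  moreover have "M \<subseteq> A" by (auto simp: M_def)
  ultimately obtain G where G: "F = (\<Prod>L\<in>M. linear_form (a L)) * G"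
    using prod_forms_dvd[OF arr_A _ homF] by blast
  \<comment> \<open>On H the second term of \<open>F\<close> drops out and the form of
    \<open>L'\<close> contributes one factor t - \<tau>. Cancelling it is what lowers the exponent
    from \<open>mult_at \<tau>\<close> by one.\<close>
  have "restr u w F = restr u w p * smult (dot (a L') w) [:- \<tau>, 1:]"
    using L' by (simp add: F_def restr_diff restr_mult restr_H restr_form)
  moreover have "restr u w (\<Prod>L\<in>M. linear_form (a L)) = smult (\<Prod>L\<in>M. dot (a L) w) ([:- \<tau>, 1:] ^ mult_at \<tau>)"
  proof -
    have "restr u w (\<Prod>L\<in>M. linear_form (a L)) = (\<Prod>L\<in>M. smult (dot (a L) w) [:- \<tau>, 1:])"
      unfolding restr_prod by (rule prod.cong) (auto simp: M_def restr_form)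
    then show ?thesis by (simp only: prod_smult prod_constant mult_at_def flip: M_def)
  qed
  ultimately have "smult (\<Prod>L\<in>M. dot (a L) w) ([:- \<tau>, 1:] ^ mult_at \<tau>) dvd
      smult (dot (a L') w) (restr u w p * [:- \<tau>, 1:])"
    using G by (metis dvd_triv_left mult_smult_right restr_mult)
  moreover have "(\<Prod>L\<in>M. dot (a L) w) \<noteq> 0"
    using finite_A gen by (auto simp: M_def)
  ultimately have "[:- \<tau>, 1:] ^ mult_at \<tau> dvd restr u w p * [:- \<tau>, 1:]"
    using gen[OF L'(1)] by (simp add: smult_dvd_iff dvd_smult_iff)
  moreover have "[:- \<tau>, 1:] ^ mult_at \<tau> = [:- \<tau>, 1:] ^ (mult_at \<tau> - 1) * [:- \<tau>, 1:]"
    by (rule power_minus_mult[OF mult_at_pos[OF \<tau>], symmetric])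
  ultimately show ?thesis
    unfolding p_def by (metis dvd_times_right_cancel_iff pCons_eq_0_iff one_neq_zero)
qed

text \<open>The upper bound for the image: the conditions at the individual points combine because
  their linear factors are coprime.\<close>

lemma restr_log_field:
  assumes v: "v \<in> log_fields A a (int k)"
  shows "restr u w (vfield v (linear_form (a H))) \<in> (\<lambda>r. ram * r) ` {r. degree r \<le> k - degree ram}"
proof -
  let ?p = "restr u w (vfield v (linear_form (a H)))"
  have "ram dvd ?p"
    unfolding ram_def using power_dvd_restr[OF v] finite_A by (intro prod_powers_dvd) auto
  then obtain r where r: "?p = ram * r" by (rule dvdE)
  have "degree ?p \<le> k"
    using v by (intro degree_restr vfield_graded) (simp add: log_fields_def)
  then have "degree r \<le> k - degree ram"
    using r ram_nonzero by (cases "r = 0") (auto simp: degree_mult_eq)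
  then show ?thesis using r by blast
qed

text \<open>The field has the constant direction of a point x on \<open>L\<close> off H and contains
  the forms of all other lines of \<open>A\<close>, so it is logarithmic for \<open>A\<close>. On H
  those forms give \<open>ram\<close> times the factors of the remaining points, and the form of H
  takes a nonzero value at x.\<close>

lemma restr_log_field_point:
  assumes L: "L \<in> A" and g: "degree g + card A \<le> Suc k"
  shows "\<exists>v\<in>log_fields A a (int k). restr u w (vfield v (linear_form (a H))) =
    ram * (g * (\<Prod>\<sigma>\<in>meet ` A - {meet L}. [:- \<sigma>, 1:]))"
proof -
  obtain x where x: "x \<in> L" "x \<notin> H"
    using arrangement_not_subset[OF arr, of L H] L H by blast
  have xH: "dot (a H) x \<noteq> 0" using arrangement_line(1)[OF arr, of H] x by blast
  have xL: "dot (a L) x = 0" using arrangement_line(1)[OF arr, of L] x L by blast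
  define h where "h = (\<Prod>L'\<in>A - {L}. linear_form (a L'))"
  have cA: "0 < card A" using L finite_A by (auto simp: card_gt_0_iff)
  define e where "e = (\<Prod>L'\<in>A - {L}. dot (a L') w)"
  have e: "e \<noteq> 0" using gen finite_A by (auto simp: e_def)
  have "restr u w h = smult e (\<Prod>L'\<in>A - {L}. [:- meet L', 1:])"
    unfolding h_def e_def restr_prod prod_smult[symmetric]
    by (rule prod.cong) (auto simp: restr_form)
  moreover have "(\<Prod>L'\<in>A - {L}. [:- meet L', 1:]) = ram * (\<Prod>\<sigma>\<in>meet ` A - {meet L}. [:- \<sigma>, 1:])"
  proof -
    have "[:- meet L, 1:] * (\<Prod>L'\<in>A - {L}. [:- meet L', 1:]) = (\<Prod>L'\<in>A. [:- meet L', 1:])"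
      by (rule prod.remove[OF finite_A L, symmetric])
    also have "\<dots> = ram * ([:- meet L, 1:] * (\<Prod>\<sigma>\<in>meet ` A - {meet L}. [:- \<sigma>, 1:]))"
      unfolding ram_times by (subst prod.remove[of _ "meet L"]) (use finite_A L in auto)
    finally have "[:- meet L, 1:] * (\<Prod>L'\<in>A - {L}. [:- meet L', 1:]) =
      [:- meet L, 1:] * (ram * (\<Prod>\<sigma>\<in>meet ` A - {meet L}. [:- \<sigma>, 1:]))"
      by (simp only: mult.left_commute)
    then show ?thesis by (simp only: mult_cancel_left) simp
  qed
  ultimately have rh: "restr u w h = smult e (ram * (\<Prod>\<sigma>\<in>meet ` A - {meet L}. [:- \<sigma>, 1:]))"
    by simp
  \<comment> \<open>The scalar compensates for the leading coefficients of the restricted forms,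
    collected in \<open>e\<close>, and for the value of the form of H at \<open>x\<close>. The
    degree is what the product of card A - 1 forms leaves from k.\<close>
  have "degree (smult (inverse (e * dot (a H) x)) g) \<le> Suc k - card A"
    using g by (intro order.trans[OF degree_smult_le]) simp
  then obtain G where G: "homogeneous (int (Suc k - card A)) G"
    "restr u w G = smult (inverse (e * dot (a H) x)) g"
    using restr_surj fr unfolding frame_def by metis
  define v where "v = const_field (h * G) x"
  have "homogeneous (\<Sum>L'\<in>A - {L}. 1) h" unfolding h_def by (intro homogeneous_prod) simp
  then have hh: "homogeneous (int (card A - 1)) h" using L finite_A by simp
  have homhG: "homogeneous (int k) (h * G)"
    using homogeneous_mult[OF hh G(1)] g cA by (simp add: of_nat_diff)
  have "vfield v (linear_form (a L')) \<in> multiples (a L') (int k)" if L': "L' \<in> A" for L'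
  proof (cases "L' = L")
    case True
    then show ?thesis
      using poly3.subspace_0[OF subspace_multiples] xL by (simp add: v_def vfield_const_field)
  next
    case False
    define h' where "h' = (\<Prod>L'\<in>A - {L} - {L'}. linear_form (a L'))"
    have hsp: "h = linear_form (a L') * h'"
      unfolding h_def h'_def using False L' finite_A by (intro prod.remove) auto
    have "homogeneous (\<Sum>L'\<in>A - {L} - {L'}. 1) h'" unfolding h'_def by (intro homogeneous_prod) simp
    moreover have "card (A - {L} - {L'}) = card A - 2"
      using L L' False finite_A by (simp add: card_Diff_subset)
    ultimately have "homogeneous (int (card A - 2)) h'" by simp
    from homogeneous_mult[OF homogeneous_mult[OF this G(1)] homogeneous_Const, of "dot (a L') x"]
    have "homogeneous (int (card A - 2) + int (Suc k - card A)) (h' * G * Const (dot (a L') x))" by simp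
    \<comment> \<open>Two distinct lines are at hand, so the natural subtraction card A - 2 does not
      truncate.\<close>
    moreover have "2 \<le> card A"
      using card_mono[OF finite_A, of "{L, L'}"] False L L' by simp
    then have "int (card A - 2) + int (Suc k - card A) = int k - 1"
      using g by linarith
    ultimately have "homogeneous (int k - 1) (h' * G * Const (dot (a L') x))"
      by (simp only:)
    then show ?thesis
      by (rule multiplesI) (simp only: v_def vfield_const_field hsp mult_ac)
  qed
  then have "v \<in> log_fields A a (int k)"
    using const_field_graded[OF homhG] by (simp add: log_fields_def v_def)
  moreover have "restr u w (vfield v (linear_form (a H))) =
      ram * (g * (\<Prod>\<sigma>\<in>meet ` A - {meet L}. [:- \<sigma>, 1:]))"
  proof -
    have "smult e (ram * P) * smult (inverse (e * dot (a H) x)) g * [:dot (a H) x:] = ram * (g * P)" for P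
      using e xH by (simp add: mult.commute mult.left_commute)
    then show ?thesis
      by (simp only: v_def vfield_const_field restr_mult restr_Const rh G(2))
  qed
  ultimately show ?thesis by blast
qed

text \<open>The interpolation splits \<open>r\<close> over the intersection points and each summand
  comes from a field of constant direction. Without lines there are no points, and a coordinate
  direction transversal to H does the work.\<close>

lemma restr_log_fields_surj:
  assumes k: "card A \<le> k" and r: "degree r \<le> k - degree ram"
  shows "\<exists>v\<in>log_fields A a (int k). restr u w (vfield v (linear_form (a H))) = ram * r"
proof (cases "A = {}")
  case True
  then have "degree r \<le> k" using r by simp
  have "a H \<noteq> 0" using fr by (simp add: frame_def)
  then obtain i where i: "a H $ i \<noteq> 0" by (auto simp: vec_eq_iff)
  have "degree (smult (inverse (a H $ i)) r) \<le> k"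
    using \<open>degree r \<le> k\<close> degree_smult_le order.trans by blast
  then obtain G where G: "homogeneous (int k) G" "restr u w G = smult (inverse (a H $ i)) r"
    using restr_surj fr unfolding frame_def by metis
  have "dot (a H) (axis i 1) = a H $ i" by (simp add: dot_def axis_def if_distrib cong: if_cong)
  moreover have "ram = 1" unfolding ram_def by (simp add: True)
  ultimately have "restr u w (vfield (const_field G (axis i 1)) (linear_form (a H))) = ram * r"
    using i G by (simp add: vfield_const_field restr_mult restr_Const)
  then show ?thesis
    using const_field_graded[OF G(1)] True by (auto simp: log_fields_def)
next
  case False
  let ?T = "meet ` A"
  \<comment> \<open>By \<open>degree_ram\<close> the degree left to the interpolation coefficients
    is exactly what the fields at single points can absorb.\<close>
  have "card ?T \<le> Suc (k - degree ram)" "Suc (k - degree ram) - card ?T = Suc k - card A"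
    using degree_ram k by simp_all
  then obtain g where g: "\<And>\<tau>. degree (g \<tau>) \<le> Suc k - card A"
    "r = (\<Sum>\<tau>\<in>?T. g \<tau> * (\<Prod>\<sigma>\<in>?T - {\<tau>}. [:- \<sigma>, 1:]))"
    using lagrange_combination[of ?T r "k - degree ram"] finite_A False r by auto
  have "\<forall>\<tau>\<in>?T. \<exists>v\<in>log_fields A a (int k). restr u w (vfield v (linear_form (a H))) =
      ram * (g \<tau> * (\<Prod>\<sigma>\<in>?T - {\<tau>}. [:- \<sigma>, 1:]))"
  proof
    fix \<tau> assume "\<tau> \<in> ?T"
    then obtain L where L: "L \<in> A" "\<tau> = meet L" by blast
    have "degree (g \<tau>) + card A \<le> Suc k" using g(1)[of \<tau>] k by simp
    from restr_log_field_point[OF L(1) this] show "\<exists>v\<in>log_fields A a (int k). 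
      restr u w (vfield v (linear_form (a H))) = ram * (g \<tau> * (\<Prod>\<sigma>\<in>?T - {\<tau>}. [:- \<sigma>, 1:]))"
      using L by simp
  qed
  then obtain v where v: "\<And>\<tau>. \<tau> \<in> ?T \<Longrightarrow> v \<tau> \<in> log_fields A a (int k)"
    "\<And>\<tau>. \<tau> \<in> ?T \<Longrightarrow> restr u w (vfield (v \<tau>) (linear_form (a H))) =
      ram * (g \<tau> * (\<Prod>\<sigma>\<in>?T - {\<tau>}. [:- \<sigma>, 1:]))"
    by metis
  have "restr u w (vfield (sum v ?T) (linear_form (a H))) = ram * r"
    unfolding vfield_sum restr_sum g(2) sum_distrib_left by (rule sum.cong) (use v(2) in auto)
  moreover have "sum v ?T \<in> log_fields A a (int k)"
    by (rule fmod.subspace_sum[OF subspace_log_fields v(1)])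
  ultimately show ?thesis by blast
qed

text \<open>Rank-nullity for the restriction of \<theta>(\<alpha>) to H, with \<alpha> the form of
  H. The kernel consists of the fields that are also logarithmic along H; the image is known by two
  inclusions. The sums on both sides avoid natural subtraction.\<close>

lemma dim_log_fields_insert_generic:
  assumes k: "card A \<le> k"
  shows "fmod.dim (log_fields A a (int k)) + card A =
    fmod.dim (log_fields (insert H A) a (int k)) + Suc k + card (meet ` A)"
proof -
  obtain B where B: "finite B" "graded_part (replicate 3 0) (int k) \<subseteq> fmod.span B"
    using graded_part_finite_spanned .
  have B': "log_fields A a (int k) \<subseteq> fmod.span B" using B(2) by (auto simp: log_fields_def)
  let ?\<psi> = "\<lambda>v. restr u w (vfield v (linear_form (a H)))"
  have "fmod.dim (log_fields A a (int k)) = fmod.dim {v \<in> log_fields A a (int k). ?\<psi> v = 0}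
      + upoly.dim (?\<psi> ` log_fields A a (int k))"
    by (rule fmod_upoly.rank_nullity_on[OF subspace_log_fields B(1) B'])
       (auto simp: vfield_add vfield_scale restr_add restr_pscale)
  also have "{v \<in> log_fields A a (int k). ?\<psi> v = 0} = log_fields (insert H A) a (int k)"
    using vfield_graded by (auto simp: log_fields_def multiples_iff_restr[OF fr])
  also have "?\<psi> ` log_fields A a (int k) = (\<lambda>r. ram * r) ` {r. degree r \<le> k - degree ram}"
  proof
    show "?\<psi> ` log_fields A a (int k) \<subseteq> (\<lambda>r. ram * r) ` {r. degree r \<le> k - degree ram}"
      using restr_log_field by blast
    show "(\<lambda>r. ram * r) ` {r. degree r \<le> k - degree ram} \<subseteq> ?\<psi> ` log_fields A a (int k)"
      using restr_log_fields_surj[OF k] by (force simp: image_iff)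
  qed
  also have "upoly.dim \<dots> = Suc (k - degree ram)" by (rule dim_mult_degree_le[OF ram_nonzero])
  finally show ?thesis using degree_ram k by simp
qed

text \<open>Different parameters span different points since \<open>u\<close> and \<open>w\<close>
  are independent. This frees the count of intersection points from the frame.\<close>

lemma card_meet:
  assumes Huw: "H = {s *s u + t *s w | s t. True}"
  shows "card (meet ` A) = card ((\<lambda>L. H \<inter> L) ` A)"
proof -
  define P where "P \<tau> = range (\<lambda>s. s *s (u + \<tau> *s w))" for \<tau>
  have on_L: "dot (a L) (s *s u + t *s w) = 0 \<longleftrightarrow> t = s * meet L" if "L \<in> A" for L s t
    using gen[OF that] by (auto simp: dot_add dot_scale meet_def field_simps add_eq_0_iff2)
  have "H \<inter> L = P (meet L)" if L: "L \<in> A" for L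
  proof (intro set_eqI iffI)
    fix x assume x: "x \<in> H \<inter> L"
    then obtain s t where st: "x = s *s u + t *s w" using Huw by blast
    have "dot (a L) x = 0" using x arrangement_line(1)[OF arr_A L] by blast
    then have "x = s *s (u + meet L *s w)"
      using on_L[OF L, of s t] st by (simp add: vec_eq_iff algebra_simps)
    then show "x \<in> P (meet L)" by (auto simp: P_def)
  next
    fix x assume "x \<in> P (meet L)"
    then obtain s where "x = s *s (u + meet L *s w)" by (auto simp: P_def)
    then have x: "x = s *s u + (s * meet L) *s w" by (simp add: vec_eq_iff algebra_simps)
    then have "dot (a L) x = 0" using on_L[OF L] by simp
    then show "x \<in> H \<inter> L" using x Huw arrangement_line(1)[OF arr_A L] by blast
  qed
  then have "(\<lambda>L. H \<inter> L) ` A = P ` meet ` A" by (force simp: image_iff)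
  moreover have "inj_on P (meet ` A)"
  proof (rule inj_onI)
    fix \<sigma> \<tau> assume "P \<sigma> = P \<tau>"
    moreover have "1 *s (u + \<sigma> *s w) \<in> P \<sigma>" unfolding P_def by blast
    ultimately obtain s where "1 *s (u + \<sigma> *s w) = s *s (u + \<tau> *s w)" by (auto simp: P_def)
    then have "(1 - s) *s u + (\<sigma> - s * \<tau>) *s w = 0" by (simp add: vec_eq_iff algebra_simps)
    then have "1 - s = 0 \<and> \<sigma> - s * \<tau> = 0" using fr unfolding frame_def indep2_def by blast
    then show "\<sigma> = \<tau>" by auto
  qed
  ultimately show ?thesis by (simp add: card_image)
qed

end

text \<open>On H each form of \<open>A\<close> vanishes at u + t w for at most one t, so all but
  finitely many t are admissible. The generic vector takes the second place of the frame, the place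
  of the point at infinity.\<close>

lemma generic_frame:
  assumes arr: "arrangement (insert H A) a" and H: "H \<notin> A"
  obtains u w where "frame (a H) u w" "H = {s *s u + t *s w | s t. True}"
    "\<And>L. L \<in> A \<Longrightarrow> dot (a L) w \<noteq> 0"
proof -
  obtain u w where uw: "frame (a H) u w" "H = {s *s u + t *s w | s t. True}"
    using arrangement_frame[OF arr] by blast
  have fin: "finite A" using arr by (simp add: arrangement_def line_arrangement_def)
  have "finite (\<Union>L\<in>A. {t. poly [:dot (a L) u, dot (a L) w:] t = 0})"
  proof (rule finite_UN_I[OF fin], rule poly_roots_finite)
    fix L assume "L \<in> A"
    then show "[:dot (a L) u, dot (a L) w:] \<noteq> 0"
      using restr_other_form[OF arr _ _ _ uw(2), of L] H by (auto simp: restr_linear_form)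
  qed
  then obtain t where t: "t \<notin> (\<Union>L\<in>A. {t. poly [:dot (a L) u, dot (a L) w:] t = 0})"
    using ex_new_if_finite[OF infinite_UNIV_char_0] by blast
  let ?w = "u + t *s w"
  have "r = 0 \<and> s = 0" if "r *s w + s *s ?w = 0" for r s
  proof -
    have "s *s u + (r + s * t) *s w = 0" using that by (simp add: vec_eq_iff algebra_simps)
    then have "s = 0 \<and> r + s * t = 0" using uw(1) unfolding frame_def indep2_def by blast
    then show ?thesis by auto
  qed
  then have "frame (a H) w ?w" using uw(1) by (auto simp: frame_def indep2_def dot_add dot_scale)
  moreover have "H = {r *s w + s *s ?w | r s. True}"
  proof -
    have "r *s w + s *s ?w = s *s u + (r + s * t) *s w" for r s by (simp add: vec_eq_iff algebra_simps)
    moreover have "s *s u + r *s w = (r - s * t) *s w + s *s ?w" for r s by (simp add: vec_eq_iff algebra_simps)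
    ultimately show ?thesis unfolding uw(2) by blast
  qed
  moreover have "dot (a L) ?w \<noteq> 0" if "L \<in> A" for L
    using t that by (auto simp: dot_add dot_scale)
  ultimately show ?thesis using that by blast
qed

theorem dim_log_fields_insert:
  assumes "arrangement (insert H A) a" "H \<notin> A" "card A \<le> k"
  shows "fmod.dim (log_fields A a (int k)) + card A =
    fmod.dim (log_fields (insert H A) a (int k)) + Suc k + card ((\<lambda>L. H \<inter> L) ` A)"
proof -
  obtain u w where uw: "frame (a H) u w" "H = {s *s u + t *s w | s t. True}"
    "\<And>L. L \<in> A \<Longrightarrow> dot (a L) w \<noteq> 0"
    using generic_frame[OF assms(1,2)] by blast
  show ?thesis
    using dim_log_fields_insert_generic[OF assms(1,2) uw(1,3) assms(3)]
      card_meet[OF assms(1,2) uw(1,3,2)] by simp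
qed


section \<open>Multiple points and the Hilbert polynomial\<close>

definition multiple_points :: "(complex^3) set set \<Rightarrow> (complex^3) set set" where
  "multiple_points A = {P. proj_point P \<and> 2 \<le> card {L \<in> A. P \<subseteq> L}}"

text \<open>The sum of (r - 1) t_r, taken over points instead of multiplicities; in this shape it
  can be followed while lines are added.\<close>

definition weight :: "(complex^3) set set \<Rightarrow> nat" where
  "weight A = (\<Sum>P\<in>multiple_points A. card {L \<in> A. P \<subseteq> L} - 1)"

lemma proj_point_Int:
  assumes "proj_line L" "proj_line L'" "L \<noteq> L'"
  shows "proj_point (L \<inter> L')"
proof -
  have sub: "vec.subspace L" "vec.subspace L'" "vec.subspace (L \<inter> L')"
    and dims: "vec.dim L = 2" "vec.dim L' = 2"
    using assms by (auto simp: proj_line_def vec.subspace_inter)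
  have "vec.dim {x + y | x y. x \<in> L \<and> y \<in> L'} \<le> vec.dim (UNIV :: (complex^3) set)"
    by (rule vec.dim_subset) simp
  also have "vec.dim (UNIV :: (complex^3) set) = 3" by (subst vec_dim_card) simp
  finally have "vec.dim {x + y | x y. x \<in> L \<and> y \<in> L'} \<le> 3" .
  then have "1 \<le> vec.dim (L \<inter> L')"
    using vec.dim_sums_Int[OF sub(1,2)] dims by simp
  moreover have "vec.dim (L \<inter> L') < 2"
  proof (rule ccontr)
    assume "\<not> vec.dim (L \<inter> L') < 2"
    then have "L \<inter> L' = L"
      using dims by (intro vec.subspace_dim_equal[OF sub(3,1)]) auto
    moreover have "L \<inter> L' = L'"
      using dims \<open>\<not> vec.dim (L \<inter> L') < 2\<close> by (intro vec.subspace_dim_equal[OF sub(3,2)]) auto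
    ultimately show False using assms by auto
  qed
  ultimately show ?thesis using sub by (simp add: proj_point_def)
qed

lemma proj_point_eq_Int:
  assumes "proj_line L" "proj_line L'" "L \<noteq> L'" "proj_point P" "P \<subseteq> L" "P \<subseteq> L'"
  shows "P = L \<inter> L'"
  using proj_point_Int[OF assms(1-3)] assms(4-6)
  by (intro vec.subspace_dim_equal) (auto simp: proj_point_def)

lemma finite_multiple_points:
  assumes "line_arrangement A"
  shows "finite (multiple_points A)"
proof (rule finite_subset)
  have fin: "finite A" using assms by (simp add: line_arrangement_def)
  then show "finite ((\<lambda>(L, L'). L \<inter> L') ` (A \<times> A))" by simp
  show "multiple_points A \<subseteq> (\<lambda>(L, L'). L \<inter> L') ` (A \<times> A)"
  proof
    fix P assume P: "P \<in> multiple_points A"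
    then obtain S where "S \<subseteq> {L \<in> A. P \<subseteq> L}" "card S = 2"
      using ex_card unfolding multiple_points_def by blast
    then obtain L L' where "L \<in> A" "P \<subseteq> L" "L' \<in> A" "P \<subseteq> L'" "L \<noteq> L'"
      by (auto simp: card_2_iff)
    moreover from this have "P = L \<inter> L'"
      using proj_point_eq_Int P assms by (auto simp: multiple_points_def line_arrangement_def)
    ultimately show "P \<in> (\<lambda>(L, L'). L \<inter> L') ` (A \<times> A)" by force
  qed
qed

text \<open>Every point of H on a line of \<open>A\<close> gains one line: a multiple point counts
  one more, and a point on one line only becomes a new double point. Points off H keep their
  count.\<close>

lemma weight_insert:
  assumes arr: "line_arrangement (insert H A)" and H: "H \<notin> A"
  shows "weight (insert H A) = weight A + card ((\<lambda>L. H \<inter> L) ` A)"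
proof -
  let ?X = "multiple_points (insert H A)"
  let ?r = "\<lambda>P. card {L \<in> A. P \<subseteq> L}"
  have fin: "finite A" and lines: "\<And>L. L \<in> insert H A \<Longrightarrow> proj_line L"
    using arr by (auto simp: line_arrangement_def)
  have finX: "finite ?X" by (rule finite_multiple_points[OF arr])
  have r': "card {L \<in> insert H A. P \<subseteq> L} = ?r P + (if P \<subseteq> H then 1 else 0)" for P
  proof -
    have "{L \<in> insert H A. P \<subseteq> L} = (if P \<subseteq> H then insert H {L \<in> A. P \<subseteq> L} else {L \<in> A. P \<subseteq> L})"
      by auto
    then show ?thesis using H fin by simp
  qed
  \<comment> \<open>Both weights are summed over the multiple points of the larger arrangement; a
    point that is new among them lies on a single line of \<open>A\<close> and adds 0.\<close>
  have "weight A = (\<Sum>P\<in>?X. ?r P - 1)"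
    unfolding weight_def
  proof (rule sum.mono_neutral_left[OF finX])
    show "multiple_points A \<subseteq> ?X" unfolding multiple_points_def r' by auto
    show "\<forall>P\<in>?X - multiple_points A. ?r P - 1 = 0" by (auto simp: multiple_points_def)
  qed
  moreover have "weight (insert H A) = (\<Sum>P\<in>?X. (?r P - 1) + (if P \<subseteq> H then 1 else 0))"
    unfolding weight_def
  proof (rule sum.cong[OF refl])
    fix P assume "P \<in> ?X"
    then show "card {L \<in> insert H A. P \<subseteq> L} - 1 = ?r P - 1 + (if P \<subseteq> H then 1 else 0)"
      unfolding multiple_points_def r' by (auto split: if_splits)
  qed
  moreover have "(\<Sum>P\<in>?X. if P \<subseteq> H then 1 else 0) = card {P \<in> ?X. P \<subseteq> H}"
    using finX by (simp add: sum.If_cases Int_def)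
  moreover have "{P \<in> ?X. P \<subseteq> H} = (\<lambda>L. H \<inter> L) ` A"
  proof (intro set_eqI iffI)
    fix P assume P: "P \<in> {P \<in> ?X. P \<subseteq> H}"
    then have "0 < ?r P" unfolding multiple_points_def r' by (auto split: if_splits)
    then obtain L where L: "L \<in> A" "P \<subseteq> L" using fin by (auto simp: card_gt_0_iff)
    then have "P = H \<inter> L"
      using P H lines by (intro proj_point_eq_Int) (auto simp: multiple_points_def)
    then show "P \<in> (\<lambda>L. H \<inter> L) ` A" using L by blast
  next
    fix P assume "P \<in> (\<lambda>L. H \<inter> L) ` A"
    then obtain L where L: "L \<in> A" "P = H \<inter> L" by blast
    then have "proj_point P" using H lines by (auto intro!: proj_point_Int)
    moreover have "0 < ?r P" using L fin by (auto simp: card_gt_0_iff)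
    ultimately show "P \<in> {P \<in> ?X. P \<subseteq> H}"
      using L unfolding multiple_points_def mem_Collect_eq r' by auto
  qed
  ultimately show ?thesis by (simp add: sum.distrib)
qed

lemma weight_eq_sum_num_points:
  assumes "line_arrangement A"
  shows "weight A = (\<Sum>r = 2..card A. (r - 1) * num_points A r)"
proof -
  let ?r = "\<lambda>P. card {L \<in> A. P \<subseteq> L}"
  have fin: "finite A" using assms by (simp add: line_arrangement_def)
  have "?r ` multiple_points A \<subseteq> {2..card A}"
    using fin by (auto simp: multiple_points_def intro: card_mono)
  from sum.group[OF finite_multiple_points[OF assms] _ this, of "\<lambda>P. ?r P - 1"]
  have "weight A = (\<Sum>r = 2..card A. \<Sum>P | P \<in> multiple_points A \<and> ?r P = r. ?r P - 1)"
    by (simp add: weight_def)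
  also have "\<dots> = (\<Sum>r = 2..card A. (r - 1) * num_points A r)"
  proof (rule sum.cong[OF refl])
    fix r assume "r \<in> {2..card A}"
    then have "{P. P \<in> multiple_points A \<and> ?r P = r} = {P. proj_point P \<and> ?r P = r}"
      by (auto simp: multiple_points_def)
    moreover have "(\<Sum>P | P \<in> multiple_points A \<and> ?r P = r. ?r P - 1) =
        (\<Sum>P | P \<in> multiple_points A \<and> ?r P = r. r - 1)"
      by (rule sum.cong) auto
    ultimately show "(\<Sum>P | P \<in> multiple_points A \<and> ?r P = r. ?r P - 1) = (r - 1) * num_points A r"
      by (simp add: num_points_def)
  qed
  finally show ?thesis .
qed

text \<open>All 3-tuples of forms are logarithmic for the empty arrangement. Each added line costs k
  + 1 - (m - n); the numbers m of lines already present sum to card A (card A - 1) / 2 and the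
  numbers n of intersection points to the weight.\<close>

lemma dim_log_fields:
  assumes "arrangement A a" "card A \<le> k"
  shows "2 * int (fmod.dim (log_fields A a (int k))) + 2 * int (card A) * (int k + 1) + 2 * int (weight A)
    = 6 * int (hilb (int k)) + int (card A) * (int (card A) - 1)"
proof -
  have "finite A" using assms by (simp add: arrangement_def line_arrangement_def)
  then show ?thesis using assms
  proof (induction A rule: finite_induct)
    case empty
    have "log_fields {} a (int k) = graded_part (replicate 3 0) (int k)" by (auto simp: log_fields_def)
    then show ?case by (simp add: dim_graded_part weight_def multiple_points_def numeral_3_eq_3)
  next
    case (insert H A)
    have "arrangement A a" using arrangement_subset[OF insert.prems(1)] by blast
    moreover have "line_arrangement (insert H A)" using insert.prems by (simp add: arrangement_def)
    ultimately show ?case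
      using insert dim_log_fields_insert[OF insert.prems(1) insert.hyps(2), of k] weight_insert[of H A]
      by (simp add: algebra_simps)
  qed
qed

text \<open>The identity between the two Hilbert functions holds for all large \<open>k\<close>; its first difference
  determines the degree \<open>e\<close> of the second syzygy, normalised by subtracting \<open>d - 1\<close>.\<close>

lemma exponents_of_hilbert_identity:
  fixes d d1 d2 d3 e s :: int
  assumes "d1 + d2 = d"
    and id: "\<And>k. k \<ge> N \<Longrightarrow> (k - d1 + 1) * (k - d1 + 2) + (k - d2 + 1) * (k - d2 + 2)
      + (k - d3 + 1) * (k - d3 + 2) - (k - e + 1) * (k - e + 2) + k * (k + 1) + 2 * d * (k + 1) + 2 * s
      = 3 * (k + 1) * (k + 2) + d * (d - 1)"
  shows "s = d1 * d2 + d3"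
proof -
  have d: "d = d1 + d2" using assms by simp
  \<comment> \<open>The quadratic terms cancel, and in the linear coefficient d1 + d2 cancels
    against d; only d3 and e remain.\<close>
  have "e = d3 + 1"
    using id[of N] id[of "N + 1"] unfolding d by (simp add: algebra_simps)
  then show ?thesis using id[of N] unfolding d by (simp add: algebra_simps)
qed

text \<open>Each factor is 1 + c t = c (t + 1/c), so nonzero exponents yield the root -1/c.\<close>

lemma splits_product:
  assumes "d1 \<noteq> 0" "d2 \<noteq> 0"
  shows "splits ([:1, d1:] * [:1, d2:] :: 'a::field poly)"
  unfolding splits_def
proof (intro exI)
  show "[:1, d1:] * [:1, d2:] = smult (d1 * d2) (\<Prod>a\<leftarrow>[- inverse d1, - inverse d2]. [:- a, 1:])"
    using assms by (simp add: field_simps)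
qed

theorem proposition4p1:
  fixes \<L> :: "(complex^3) set set" and f :: poly3 and d d1 d2 d3 :: nat
  assumes "line_arrangement \<L>" and "card \<L> = d"
    and "defining_polynomial \<L> f"
    and "plus_one_generated d f d1 d2 d3"
  shows "splits (poincare_poly \<L> d3) \<and>
         poincare_poly \<L> d3 = [:1, of_nat d1:] * [:1, of_nat d2:]"
proof -
  obtain a where a: "arrangement \<L> a" "f = (\<Prod>L\<in>\<L>. linear_form (a L))"
    using assms(1,3) unfolding defining_polynomial_def arrangement_def dot_def by blast
  have d: "d1 + d2 = d" and pos: "1 \<le> d1" "1 \<le> d2" and hom: "homogeneous (int d) f"
    using assms(4) by (auto simp: plus_one_generated_def syzygy_curve_def)
  obtain es where es: "length [d1, d2, d3] = length es + 2" "minimal_resolution_milnor f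
      (replicate 3 (int d - 1)) (map (\<lambda>a. int d - 1 + int a) [d1, d2, d3]) es"
    using assms(4) unfolding plus_one_generated_def syzygy_curve_def by blast
  obtain e where e: "es = [e]" using es(1) by (cases es) auto
  \<comment> \<open>The twist of the last module, measured like the exponents in degrees of the
    coefficients.\<close>
  define g where "g = e - (int d - 1)"
  have ne: "\<L> \<noteq> {}" using d pos assms(2) by auto
  \<comment> \<open>The coefficient of t already agrees by d1 + d2 = d, so this identity is the
    whole content of the factorisation.\<close>
  have "int (weight \<L>) = int d1 * int d2 + int d3"
  proof (rule exponents_of_hilbert_identity)
    show "int d1 + int d2 = int d" using d by simp
    \<comment> \<open>Large enough for \<open>dim_log_fields\<close> and for all shifted degrees to
      lie where the Hilbert function is polynomial. The absolute value appears because
      \<open>g\<close> is not yet known.\<close>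
    fix k :: int assume k: "k \<ge> int d + int d3 + \<bar>g\<bar>"
    then have "0 \<le> k" by linarith
    from k obtain n where n: "k = int n" "d \<le> n"
      by (metis abs_ge_zero add_increasing2 le_add_same_cancel1 nat_le_iff of_nat_0_le_iff 
          order.trans zle_int zero_le_imp_eq_int)
    have syz: "int (fmod.dim (syzygies f k)) =
      int (hilb (k - int d1)) + int (hilb (k - int d2)) + int (hilb (k - int d3)) - int (hilb (k - g))"
      using dim_syzygies[OF hom es(2)[unfolded e], of k] by (simp add: g_def algebra_simps)
    have "2 * int (hilb (k - int d1)) = (k - int d1 + 1) * (k - int d1 + 2)"
      "2 * int (hilb (k - int d2)) = (k - int d2 + 1) * (k - int d2 + 2)"
      "2 * int (hilb (k - int d3)) = (k - int d3 + 1) * (k - int d3 + 2)"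
      "2 * int (hilb (k - g)) = (k - g + 1) * (k - g + 2)"
      using k d by (intro hilb_eq; linarith)+
    moreover have "2 * int (hilb (k - 1)) = k * (k + 1)" "6 * int (hilb k) = 3 * (k + 1) * (k + 2)"
      using hilb_eq[of "k - 1"] hilb_eq[of k] \<open>0 \<le> k\<close> by (simp_all add: algebra_simps)
    moreover have "2 * int (fmod.dim (log_fields \<L> a k)) + 2 * int d * (k + 1) + 2 * int (weight \<L>)
        = 6 * int (hilb k) + int d * (int d - 1)"
      using dim_log_fields[OF a(1), of n] n assms(2) by simp
    ultimately show "(k - int d1 + 1) * (k - int d1 + 2) + (k - int d2 + 1) * (k - int d2 + 2)
      + (k - int d3 + 1) * (k - int d3 + 2) - (k - g + 1) * (k - g + 2) + k * (k + 1)
      + 2 * int d * (k + 1) + 2 * int (weight \<L>) = 3 * (k + 1) * (k + 2) + int d * (int d - 1)"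
      using dim_log_fields_syzygies[OF a(1) ne a(2), of k] syz by simp
  qed
  then have w: "weight \<L> = d1 * d2 + d3" by (simp flip: of_nat_mult of_nat_add)
  have "(\<Sum>r = 2..card \<L>. (of_nat r - 1) * of_nat (num_points \<L> r)) = (of_nat (weight \<L>) :: rat)"
    unfolding weight_eq_sum_num_points[OF assms(1)] of_nat_sum
    by (rule sum.cong) (auto simp: of_nat_diff)
  then have "poincare_poly \<L> d3 = [:1, of_nat d1:] * [:1, of_nat d2:]"
    using d assms(2) by (auto simp: poincare_poly_def w)
  then show ?thesis using pos splits_product[of "of_nat d1 :: rat" "of_nat d2"] by simp
qed

end
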